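(* Let $\lambda\in\mathbb{Q}\setminus\{0\}$, and let $\mathcal{H}=\mathbb{Q}\langle L\rangle/\mathcal{T}_-$, identified with $\langle Y\rangle_{\mathbb{Q}}$. Then the quintuple $\mathcal{H}_\lambda=(\mathcal{H},\diamond_\lambda,\eta,\Delta_\lambda,\varepsilon)$ is a Hopf algebra, where $\diamond_\lambda$, $\eta$ and $\varepsilon$ are induced on the quotient from $\mathbb{Q}\langle L\rangle$, and where for any word $w\in Y$ $$\Delta_\lambda(w):=\overline{\Delta}_\lambda(w) \mod \big(\mathcal{T}_-\otimes\mathbb{Q}\langle L\rangle+\mathbb{Q}\langle L\rangle\otimes\mathcal{T}_-\big).$$
   Context: Let $L=\{d,y\}$ be an alphabet with two letters, $L^*$ the free monoid on $L$ with empty word $\mathbf{1}$, and $\mathbb{Q}\langle L\rangle$ the free associative algebra (concatenation product), with basis $L^*$. Let $\mathcal{T}_-:=\langle wd : w\in L^*\rangle_{\mathbb{Q}}$ be the span of words ending in $d$, and $Y:=L^*y\cup\{\mathbf{1}\}$, so that $\mathbb{Q}\langle L\rangle/\mathcal{T}_-\cong\langle Y\rangle_{\mathbb{Q}}$ as vector spaces. For $\lambda\neq0$ the (shuffle-type) bilinear product $\diamond_\lambda:\mathbb{Q}\langle L\rangle\otimes\mathbb{Q}\langle L\rangle\to\mathbb{Q}\langle L\rangle$ is defined recursively by: (P1) $\mathbf{1}\diamond_\lambda w=w\diamond_\lambda\mathbf{1}=w$ for $w\in L^*$; (P2) $yu\diamond_\lambda v=u\diamond_\lambda yv=y(u\diamond_\lambda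 v)$ for $u,v\in L^*$; (P3) $du\diamond_\lambda dv=\frac1\lambda\big[d(u\diamond_\lambda v)-du\diamond_\lambda v-u\diamond_\lambda dv\big]$ for $u,v\in L^*$. The unit map is $\eta:\mathbb{Q}\to\mathbb{Q}\langle L\rangle$, $1\mapsto\mathbf{1}$. The coproduct $\overline{\Delta}_\lambda:\mathbb{Q}\langle L\rangle\to\mathbb{Q}\langle L\rangle\otimes\mathbb{Q}\langle L\rangle$ is the unique algebra morphism for concatenation with $\overline{\Delta}_\lambda(y)=\mathbf{1}\otimes y+y\otimes\mathbf{1}$ and $\overline{\Delta}_\lambda(d)=\mathbf{1}\otimes d+d\otimes\mathbf{1}+\lambda\, d\otimes d$. The counit $\varepsilon$ is given by $\varepsilon(\mathbf{1})=1$, $\varepsilon(w)=0$ for $w\in L^*\setminus\{\mathbf{1}\}$. *)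

theory Defs
  imports Complex_Main "HOL-Library.Poly_Mapping"
begin

section \<open>Rational vector spaces\<close>

class rat_vector = ab_group_add +
  fixes scaleQ :: "rat \<Rightarrow> 'a \<Rightarrow> 'a" (infixr \<open>*\<^sub>Q\<close> 75)
  assumes scaleQ_add_right: "a *\<^sub>Q (x + y) = a *\<^sub>Q x + a *\<^sub>Q y"
    and scaleQ_add_left: "(a + b) *\<^sub>Q x = a *\<^sub>Q x + b *\<^sub>Q x"
    and scaleQ_scaleQ: "a *\<^sub>Q b *\<^sub>Q x = (a * b) *\<^sub>Q x"
    and scaleQ_one: "1 *\<^sub>Q x = x"

global_interpretation rat_vector: vector_space "scaleQ :: rat \<Rightarrow> 'a \<Rightarrow> 'a::rat_vector"
  by unfold_locales (simp_all add: scaleQ_add_right scaleQ_add_left scaleQ_scaleQ scaleQ_one)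

abbreviation qlinear :: "('a::rat_vector \<Rightarrow> 'b::rat_vector) \<Rightarrow> bool"
  where "qlinear \<equiv> Vector_Spaces.linear scaleQ scaleQ"

definition qbilinear :: "('a::rat_vector \<Rightarrow> 'b::rat_vector \<Rightarrow> 'c::rat_vector) \<Rightarrow> bool"
  where "qbilinear f \<longleftrightarrow> (\<forall>b. qlinear (\<lambda>a. f a b)) \<and> (\<forall>a. qlinear (f a))"

lemma qlinearI:
  assumes "\<And>x y. f (x + y) = f x + f y" "\<And>c x. f (c *\<^sub>Q x) = c *\<^sub>Q f x"
  shows "qlinear f"
  using assms by unfold_locales

lemma qlinear_add: "qlinear f \<Longrightarrow> f (x + y) = f x + f y"
  by (simp add: Vector_Spaces.linear_iff)

lemma qlinear_scale: "qlinear f \<Longrightarrow> f (c *\<^sub>Q x) = c *\<^sub>Q f x"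
  by (simp add: Vector_Spaces.linear_iff)

lemma qlinear_zero: "qlinear f \<Longrightarrow> f 0 = 0"
  by (metis qlinear_scale rat_vector.scale_zero_left)

lemma qlinear_diff: "qlinear f \<Longrightarrow> f (x - y) = f x - f y"
  by (metis qlinear_add diff_add_cancel eq_diff_eq)

lemma qlinear_sum: "qlinear f \<Longrightarrow> f (sum g A) = (\<Sum>x\<in>A. f (g x))"
  by (induction A rule: infinite_finite_induct) (auto simp: qlinear_zero qlinear_add)

lemma qlinear_comp: "qlinear f \<Longrightarrow> qlinear g \<Longrightarrow> qlinear (\<lambda>x. g (f x))"
  by (intro qlinearI) (simp_all add: qlinear_add qlinear_scale)

lemma qlinear_plus: "qlinear f \<Longrightarrow> qlinear g \<Longrightarrow> qlinear (\<lambda>x. f x + g x)"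
  by (intro qlinearI) (simp_all add: qlinear_add qlinear_scale scaleQ_add_right algebra_simps)

lemma qlinear_zero_map: "qlinear (\<lambda>x. 0)"
  by (intro qlinearI) simp_all

lemma qlinear_scaled: "qlinear f \<Longrightarrow> qlinear (\<lambda>x. c *\<^sub>Q f x)"
  by (intro qlinearI) (simp_all add: qlinear_add qlinear_scale scaleQ_add_right mult.commute)

lemma qlinear_sum_map: "(\<And>i. i \<in> A \<Longrightarrow> qlinear (f i)) \<Longrightarrow> qlinear (\<lambda>x. \<Sum>i\<in>A. f i x)"
  by (induction A rule: infinite_finite_induct) (auto intro: qlinear_plus qlinear_zero_map)

lemma qlinear_eq_0_on_span:
  assumes "qlinear f" "\<And>x. x \<in> S \<Longrightarrow> f x = 0" "x \<in> rat_vector.span S"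
  shows "f x = 0"
  using assms(3)
  by (induction rule: rat_vector.span_induct_alt)
     (simp_all add: qlinear_zero qlinear_add qlinear_scale assms)

instantiation rat :: rat_vector
begin
definition scaleQ_rat :: "rat \<Rightarrow> rat \<Rightarrow> rat" where [simp]: "scaleQ_rat a x = a * x"
instance by standard (simp_all add: algebra_simps)
end

instantiation poly_mapping :: (type, rat_vector) rat_vector
begin
definition scaleQ_poly_mapping :: "rat \<Rightarrow> ('a \<Rightarrow>\<^sub>0 'b) \<Rightarrow> 'a \<Rightarrow>\<^sub>0 'b"
  where "scaleQ_poly_mapping c = Poly_Mapping.map (scaleQ c)"
lemma lookup_scaleQ [simp]: "Poly_Mapping.lookup (c *\<^sub>Q p) x = c *\<^sub>Q Poly_Mapping.lookup p x"
  by (auto simp: scaleQ_poly_mapping_def Poly_Mapping.map.rep_eq when_def)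
instance
  by standard
    (auto intro!: poly_mapping_eqI simp: Poly_Mapping.lookup_add scaleQ_add_right scaleQ_add_left)
end

text \<open>The rational vector space with basis \<open>'x\<close> is \<open>'x \<Rightarrow>\<^sub>0 rat\<close>; \<open>lin_ext f\<close> is the linear
  extension of a function \<open>f\<close> given on the basis.\<close>

definition lin_ext :: "('x \<Rightarrow> 'c::rat_vector) \<Rightarrow> ('x \<Rightarrow>\<^sub>0 rat) \<Rightarrow> 'c"
  where "lin_ext f p = (\<Sum>x\<in>Poly_Mapping.keys p. Poly_Mapping.lookup p x *\<^sub>Q f x)"

lemma lin_ext_superset:
  assumes "finite A" "Poly_Mapping.keys p \<subseteq> A"
  shows "lin_ext f p = (\<Sum>x\<in>A. Poly_Mapping.lookup p x *\<^sub>Q f x)"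
  unfolding lin_ext_def using assms
  by (intro sum.mono_neutral_left) (auto simp: Poly_Mapping.in_keys_iff)

lemma qlinear_lin_ext: "qlinear (lin_ext f)"
proof (rule qlinearI)
  fix p q :: "'a \<Rightarrow>\<^sub>0 rat"
  let ?A = "Poly_Mapping.keys p \<union> Poly_Mapping.keys q"
  have "lin_ext f (p + q) = (\<Sum>x\<in>?A. Poly_Mapping.lookup (p + q) x *\<^sub>Q f x)"
    by (intro lin_ext_superset) (auto simp: Poly_Mapping.in_keys_iff Poly_Mapping.lookup_add)
  also have "\<dots> = (\<Sum>x\<in>?A. Poly_Mapping.lookup p x *\<^sub>Q f x) + (\<Sum>x\<in>?A. Poly_Mapping.lookup q x *\<^sub>Q f x)"
    by (simp add: Poly_Mapping.lookup_add scaleQ_add_left sum.distrib)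
  also have "\<dots> = lin_ext f p + lin_ext f q"
    by (simp add: lin_ext_superset[of ?A p] lin_ext_superset[of ?A q])
  finally show "lin_ext f (p + q) = lin_ext f p + lin_ext f q" .
next
  fix c and p :: "'a \<Rightarrow>\<^sub>0 rat"
  have "lin_ext f (c *\<^sub>Q p) = (\<Sum>x\<in>Poly_Mapping.keys p. Poly_Mapping.lookup (c *\<^sub>Q p) x *\<^sub>Q f x)"
    by (intro lin_ext_superset) (auto simp: Poly_Mapping.in_keys_iff)
  then show "lin_ext f (c *\<^sub>Q p) = c *\<^sub>Q lin_ext f p"
    by (simp add: lin_ext_def rat_vector.scale_sum_right)
qed

lemma lin_ext_single [simp]: "lin_ext f (Poly_Mapping.single x c) = c *\<^sub>Q f x"
  by (simp add: lin_ext_def)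

lemma free_expand:
  fixes p :: "'x \<Rightarrow>\<^sub>0 rat"
  shows "p = (\<Sum>x\<in>Poly_Mapping.keys p. Poly_Mapping.lookup p x *\<^sub>Q Poly_Mapping.single x 1)"
  by (rule poly_mapping_eqI)
     (auto simp: Poly_Mapping.lookup_sum Poly_Mapping.lookup_single when_def sum.delta' Poly_Mapping.in_keys_iff if_distrib cong: if_cong)

lemma free_linear_ext:
  fixes f g :: "('x \<Rightarrow>\<^sub>0 rat) \<Rightarrow> 'c::rat_vector"
  assumes "qlinear f" "qlinear g"
    and "\<And>x. f (Poly_Mapping.single x 1) = g (Poly_Mapping.single x 1)"
  shows "f p = g p"
  by (subst (1 2) free_expand[of p]) (simp add: qlinear_sum qlinear_scale assms)

lemma lin_ext_cong_qlinear:
  assumes "qlinear g" shows "g (lin_ext f p) = lin_ext (\<lambda>x. g (f x)) p"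
  using assms by (simp add: lin_ext_def qlinear_sum qlinear_scale)


section \<open>Tensor products of rational vector spaces\<close>

definition tensor_rels :: "('a::rat_vector \<times> 'b::rat_vector \<Rightarrow>\<^sub>0 rat) set"
  where "tensor_rels =
      {Poly_Mapping.single (a + a', b) 1 - Poly_Mapping.single (a, b) 1
         - Poly_Mapping.single (a', b) 1 | a a' b. True}
    \<union> {Poly_Mapping.single (a, b + b') 1 - Poly_Mapping.single (a, b) 1
         - Poly_Mapping.single (a, b') 1 | a b b'. True}
    \<union> {Poly_Mapping.single (c *\<^sub>Q a, b) 1 - Poly_Mapping.single (a, b) c | c a b. True}
    \<union> {Poly_Mapping.single (a, c *\<^sub>Q b) 1 - Poly_Mapping.single (a, b) c | c a b. True}"

lemma span_congs:
  assumes "p - p' \<in> rat_vector.span S" "q - q' \<in> rat_vector.span S"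
  shows "p + q - (p' + q') \<in> rat_vector.span S" "p - q - (p' - q') \<in> rat_vector.span S"
    "- p - - p' \<in> rat_vector.span S" "c *\<^sub>Q p - c *\<^sub>Q p' \<in> rat_vector.span S"
proof -
  show "p + q - (p' + q') \<in> rat_vector.span S"
    using rat_vector.span_add[OF assms] by (simp add: add_diff_add)
  have "(p - p') - (q - q') = p - q - (p' - q')" by simp
  with rat_vector.span_diff[OF assms] show "p - q - (p' - q') \<in> rat_vector.span S" by metis
  show "- p - - p' \<in> rat_vector.span S"
    using rat_vector.span_neg[OF assms(1)] by simp
  show "c *\<^sub>Q p - c *\<^sub>Q p' \<in> rat_vector.span S"
    using rat_vector.span_scale[OF assms(1)] by (simp add: rat_vector.scale_right_diff_distrib)
qed

lemma equivp_span: "equivp (\<lambda>p q. p - q \<in> rat_vector.span S)"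
proof (rule equivpI)
  show "symp (\<lambda>p q. p - q \<in> rat_vector.span S)"
    by (rule sympI) (metis minus_diff_eq rat_vector.span_neg)
  show "transp (\<lambda>p q. p - q \<in> rat_vector.span S)"
    by (rule transpI) (drule (1) rat_vector.span_add, simp)
qed (simp add: reflp_def rat_vector.span_zero)

quotient_type (overloaded) ('a, 'b) tensor =
  "('a::rat_vector \<times> 'b::rat_vector) \<Rightarrow>\<^sub>0 rat" / "\<lambda>p q. p - q \<in> rat_vector.span tensor_rels"
  by (rule equivp_span)

instantiation tensor :: (rat_vector, rat_vector) rat_vector
begin

lift_definition zero_tensor :: "('a, 'b) tensor" is 0 .

lift_definition plus_tensor :: "('a, 'b) tensor \<Rightarrow> ('a, 'b) tensor \<Rightarrow> ('a, 'b) tensor" is "(+)"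
  by (rule span_congs(1))

lift_definition minus_tensor :: "('a, 'b) tensor \<Rightarrow> ('a, 'b) tensor \<Rightarrow> ('a, 'b) tensor" is "(-)"
  by (rule span_congs(2))

lift_definition uminus_tensor :: "('a, 'b) tensor \<Rightarrow> ('a, 'b) tensor" is uminus
  by (rule span_congs(3))

lift_definition scaleQ_tensor :: "rat \<Rightarrow> ('a, 'b) tensor \<Rightarrow> ('a, 'b) tensor" is scaleQ
  by (rule span_congs(4))

instance
proof
  fix u v w :: "('a, 'b) tensor" and a b :: rat
  note eqs = zero_tensor_def plus_tensor.abs_eq minus_tensor.abs_eq uminus_tensor.abs_eq scaleQ_tensor.abs_eq
  show "u + v + w = u + (v + w)"
    by (induction u; induction v; induction w) (simp add: eqs add.assoc)
  show "u + v = v + u"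
    by (induction u; induction v) (simp add: eqs add.commute)
  show "0 + u = u" "- u + u = 0"
    by (induction u; simp add: eqs)+
  show "u - v = u + - v"
    by (induction u; induction v) (simp add: eqs)
  show "a *\<^sub>Q (u + v) = a *\<^sub>Q u + a *\<^sub>Q v"
    by (induction u; induction v) (simp add: eqs scaleQ_add_right)
  show "(a + b) *\<^sub>Q u = a *\<^sub>Q u + b *\<^sub>Q u" "a *\<^sub>Q b *\<^sub>Q u = (a * b) *\<^sub>Q u" "1 *\<^sub>Q u = u"
    by (induction u; simp add: eqs scaleQ_add_left)+
qed

end

lift_definition tensor :: "'a::rat_vector \<Rightarrow> 'b::rat_vector \<Rightarrow> ('a, 'b) tensor"  (infixr \<open>\<otimes>\<close> 70)
  is "\<lambda>a b. Poly_Mapping.single (a, b) 1" .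

text \<open>The linear map on the tensor product induced by a bilinear map \<open>f\<close>.  It is defined by
  choosing representatives; \<open>tlift_tensor\<close>, \<open>qlinear_tlift\<close> and \<open>tlift_unique\<close> show that for
  bilinear \<open>f\<close> this is the map given by the universal property.\<close>

definition tlift ::
    "('a::rat_vector \<Rightarrow> 'b::rat_vector \<Rightarrow> 'c::rat_vector) \<Rightarrow> ('a, 'b) tensor \<Rightarrow> 'c"
  where "tlift f t = lin_ext (\<lambda>(a, b). f a b) (rep_tensor t)"

lemma qbilinearD:
  assumes "qbilinear f"
  shows "f (a + a') b = f a b + f a' b" "f a (b + b') = f a b + f a b'"
    "f (c *\<^sub>Q a) b = c *\<^sub>Q f a b" "f a (c *\<^sub>Q b) = c *\<^sub>Q f a b"
    "f (a - a') b = f a b - f a' b" "f a (b - b') = f a b - f a b'"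
    "f 0 b = 0" "f a 0 = 0"
  using assms unfolding qbilinear_def
  by (auto dest: spec simp: qlinear_add qlinear_scale qlinear_diff qlinear_zero
      intro: qlinear_add[of "\<lambda>a. f a b"] qlinear_scale[of "\<lambda>a. f a b"]
        qlinear_diff[of "\<lambda>a. f a b"] qlinear_zero[of "\<lambda>a. f a b"])

lemma qbilinearI:
  assumes "\<And>a a' b. f (a + a') b = f a b + f a' b" "\<And>a b b'. f a (b + b') = f a b + f a b'"
    "\<And>c a b. f (c *\<^sub>Q a) b = c *\<^sub>Q f a b" "\<And>c a b. f a (c *\<^sub>Q b) = c *\<^sub>Q f a b"
  shows "qbilinear f"
  unfolding qbilinear_def by (intro conjI allI qlinearI assms)

lemma tlift_abs:
  assumes "qbilinear f"
  shows "tlift f (abs_tensor p) = lin_ext (\<lambda>(a, b). f a b) p"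
proof -
  let ?r = "rep_tensor (abs_tensor p :: ('a, 'b) tensor)"
  have "abs_tensor ?r = (abs_tensor p :: ('a, 'b) tensor)"
    by (rule Quotient_abs_rep[OF Quotient_tensor])
  then have "?r - p \<in> rat_vector.span tensor_rels"
    by (simp add: tensor.abs_eq_iff)
  moreover have "lin_ext (\<lambda>(a, b). f a b) x = 0" if "x \<in> tensor_rels" for x
    using that
    by (auto simp: tensor_rels_def qlinear_diff[OF qlinear_lin_ext] qbilinearD[OF assms] scaleQ_one)
  ultimately have "lin_ext (\<lambda>(a, b). f a b) (?r - p) = 0"
    by (rule qlinear_eq_0_on_span[OF qlinear_lin_ext, rotated])
  then show ?thesis by (simp add: tlift_def qlinear_diff[OF qlinear_lin_ext])
qed

lemma tlift_tensor [simp]: "qbilinear f \<Longrightarrow> tlift f (a \<otimes> b) = f a b"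
  by (simp add: tensor.abs_eq tlift_abs scaleQ_one)

lemma qlinear_tlift: "qbilinear f \<Longrightarrow> qlinear (tlift f)"
proof (rule qlinearI)
  assume f: "qbilinear f"
  show "tlift f (s + t) = tlift f s + tlift f t" for s t
    by (induction s; induction t)
       (simp add: plus_tensor.abs_eq tlift_abs[OF f] qlinear_add[OF qlinear_lin_ext])
  show "tlift f (c *\<^sub>Q t) = c *\<^sub>Q tlift f t" for c t
    by (induction t)
       (simp add: scaleQ_tensor.abs_eq tlift_abs[OF f] qlinear_scale[OF qlinear_lin_ext])
qed

lemma qbilinear_tensor: "qbilinear (\<otimes>)"
proof (rule qbilinearI)
  fix a a' :: 'a and b b' :: 'b and c :: rat
  have s: "c *\<^sub>Q Poly_Mapping.single (x :: 'a \<times> 'b) (1 :: rat) = Poly_Mapping.single x c" for x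
    by (rule poly_mapping_eqI) (simp add: Poly_Mapping.lookup_single when_def)
  have "Poly_Mapping.single (a + a', b) 1 - Poly_Mapping.single (a, b) 1
      - Poly_Mapping.single (a', b) 1 \<in> tensor_rels"
    unfolding tensor_rels_def by blast
  from rat_vector.span_base[OF this] show "(a + a') \<otimes> b = a \<otimes> b + a' \<otimes> b"
    by (simp add: tensor.abs_eq plus_tensor.abs_eq tensor.abs_eq_iff diff_diff_eq)
  have "Poly_Mapping.single (a, b + b') 1 - Poly_Mapping.single (a, b) 1
      - Poly_Mapping.single (a, b') 1 \<in> tensor_rels"
    unfolding tensor_rels_def by blast
  from rat_vector.span_base[OF this] show "a \<otimes> (b + b') = a \<otimes> b + a \<otimes> b'"
    by (simp add: tensor.abs_eq plus_tensor.abs_eq tensor.abs_eq_iff diff_diff_eq)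
  have "Poly_Mapping.single (c *\<^sub>Q a, b) 1 - Poly_Mapping.single (a, b) c \<in> tensor_rels"
    unfolding tensor_rels_def by blast
  from rat_vector.span_base[OF this] show "(c *\<^sub>Q a) \<otimes> b = c *\<^sub>Q (a \<otimes> b)"
    by (simp add: tensor.abs_eq scaleQ_tensor.abs_eq tensor.abs_eq_iff s)
  have "Poly_Mapping.single (a, c *\<^sub>Q b) 1 - Poly_Mapping.single (a, b) c \<in> tensor_rels"
    unfolding tensor_rels_def by blast
  from rat_vector.span_base[OF this] show "a \<otimes> (c *\<^sub>Q b) = c *\<^sub>Q (a \<otimes> b)"
    by (simp add: tensor.abs_eq scaleQ_tensor.abs_eq tensor.abs_eq_iff s)
qed

lemma tensor_expand:
  "t = lin_ext (\<lambda>(a, b). a \<otimes> b) (rep_tensor t)"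
proof -
  have lin: "qlinear (abs_tensor :: ('a \<times> 'b \<Rightarrow>\<^sub>0 rat) \<Rightarrow> ('a, 'b) tensor)"
    by (rule qlinearI) (simp_all add: plus_tensor.abs_eq scaleQ_tensor.abs_eq)
  have "t = abs_tensor (rep_tensor t)"
    by (simp add: Quotient_abs_rep[OF Quotient_tensor])
  also have "\<dots> = lin_ext (\<lambda>(a, b). a \<otimes> b) (rep_tensor t)"
    by (rule free_linear_ext[OF lin qlinear_lin_ext]) (auto simp: tensor.abs_eq scaleQ_one)
  finally show ?thesis .
qed

lemma tlift_unique:
  assumes "qlinear g" "qlinear h" "\<And>a b. g (a \<otimes> b) = h (a \<otimes> b)"
  shows "g t = h t"
proof -
  have "g (lin_ext (\<lambda>(a, b). a \<otimes> b) p) = h (lin_ext (\<lambda>(a, b). a \<otimes> b) p)" for p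
    by (simp add: lin_ext_cong_qlinear[OF assms(1)] lin_ext_cong_qlinear[OF assms(2)]
        case_prod_unfold assms(3))
  from this[of "rep_tensor t"] show ?thesis by (simp only: tensor_expand[symmetric])
qed

definition tmap :: "('a::rat_vector \<Rightarrow> 'c::rat_vector) \<Rightarrow> ('b::rat_vector \<Rightarrow> 'd::rat_vector)
    \<Rightarrow> ('a, 'b) tensor \<Rightarrow> ('c, 'd) tensor"
  where "tmap f g = tlift (\<lambda>a b. f a \<otimes> g b)"

lemma qbilinear_tmap: "qlinear f \<Longrightarrow> qlinear g \<Longrightarrow> qbilinear (\<lambda>a b. f a \<otimes> g b)"
  by (intro qbilinearI) (simp_all add: qlinear_add qlinear_scale qbilinearD[OF qbilinear_tensor])

lemma tmap_tensor: "qlinear f \<Longrightarrow> qlinear g \<Longrightarrow> tmap f g (a \<otimes> b) = f a \<otimes> g b"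
  by (simp add: tmap_def qbilinear_tmap)

lemma qlinear_tmap: "qlinear f \<Longrightarrow> qlinear g \<Longrightarrow> qlinear (tmap f g)"
  by (simp add: tmap_def qbilinear_tmap qlinear_tlift)

definition tassoc :: "(('a::rat_vector, 'b::rat_vector) tensor, 'c::rat_vector) tensor
    \<Rightarrow> ('a, ('b, 'c) tensor) tensor"
  where "tassoc = tlift (\<lambda>t c. tlift (\<lambda>a b. a \<otimes> (b \<otimes> c)) t)"

text \<open>The product \<open>(a \<otimes> b) (a' \<otimes> b') = m a a' \<otimes> n b b'\<close> on the tensor product of two algebras.\<close>

definition tmult :: "('a::rat_vector \<Rightarrow> 'a \<Rightarrow> 'a) \<Rightarrow> ('b::rat_vector \<Rightarrow> 'b \<Rightarrow> 'b)
    \<Rightarrow> ('a, 'b) tensor \<Rightarrow> ('a, 'b) tensor \<Rightarrow> ('a, 'b) tensor"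
  where "tmult m n s t = tlift (\<lambda>a b. tlift (\<lambda>a' b'. m a a' \<otimes> n b b') t) s"

lemma tlift_add_fun:
  assumes "\<And>a b. f a b = g a b + h a b"
  shows "tlift f t = tlift g t + tlift h t"
  by (simp add: tlift_def lin_ext_def assms scaleQ_add_right sum.distrib case_prod_unfold)

lemma tlift_scale_fun:
  assumes "\<And>a b. f a b = c *\<^sub>Q g a b"
  shows "tlift f t = c *\<^sub>Q tlift g t"
  by (simp add: tlift_def lin_ext_def assms rat_vector.scale_sum_right case_prod_unfold mult.commute)

lemma qbilinear_tlift_param:
  assumes "\<And>c. qbilinear (\<lambda>a b. f a b c)" "\<And>a b. qlinear (f a b)"
  shows "qbilinear (\<lambda>t c. tlift (\<lambda>a b. f a b c) t)"
  by (intro qbilinearI qlinear_add[OF qlinear_tlift] qlinear_scale[OF qlinear_tlift] assms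
      tlift_add_fun tlift_scale_fun) (simp_all add: qlinear_add qlinear_scale assms)

lemma tassoc_tensor [simp]: "tassoc ((a \<otimes> b) \<otimes> c) = a \<otimes> (b \<otimes> c)"
proof -
  have 1: "qbilinear (\<lambda>(a :: 'a) (b :: 'b). a \<otimes> (b \<otimes> c))" for c :: 'c
    by (intro qbilinearI) (simp_all add: qbilinearD[OF qbilinear_tensor])
  have 2: "qlinear (\<lambda>(c :: 'c). a \<otimes> (b \<otimes> c))" for a :: 'a and b :: 'b
    by (intro qlinearI) (simp_all add: qbilinearD[OF qbilinear_tensor])
  show ?thesis
    unfolding tassoc_def tlift_tensor[OF qbilinear_tlift_param[OF 1 2]] tlift_tensor[OF 1] ..
qed

lemma
  assumes m: "qbilinear m" and n: "qbilinear n"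
  shows qbilinear_tmult: "qbilinear (tmult m n)"
    and tmult_tensor: "tmult m n (a \<otimes> b) (a' \<otimes> b') = m a a' \<otimes> n b b'"
proof -
  note simps = qbilinearD[OF m] qbilinearD[OF n] qbilinearD[OF qbilinear_tensor]
  have 1: "qbilinear (\<lambda>a' b'. m a a' \<otimes> n b b')" for a b
    by (intro qbilinearI) (simp_all add: simps)
  have 2: "qbilinear (\<lambda>a b. tlift (\<lambda>a' b'. m a a' \<otimes> n b b') t)" for t
    by (intro qbilinearI tlift_add_fun tlift_scale_fun) (simp_all add: simps)
  have 3: "qlinear (tlift (\<lambda>a' b'. m a a' \<otimes> n b b'))" for a b
    by (rule qlinear_tlift[OF 1])
  have 4: "qbilinear (\<lambda>a b. m a a' \<otimes> n b b')" for a' b'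
    by (intro qbilinearI) (simp_all add: simps)
  show "qbilinear (tmult m n)"
    using qbilinear_tlift_param[OF 2 3] by (simp add: tmult_def[abs_def])
  show "tmult m n (a \<otimes> b) (a' \<otimes> b') = m a a' \<otimes> n b b'"
    unfolding tmult_def tlift_tensor[OF 1] by (rule tlift_tensor[OF 4])
qed


section \<open>Hopf algebras over the rationals\<close>

definition algebra_axioms :: "('a::rat_vector \<Rightarrow> 'a \<Rightarrow> 'a) \<Rightarrow> (rat \<Rightarrow> 'a) \<Rightarrow> bool"
  where "algebra_axioms m \<eta> \<longleftrightarrow>
    qbilinear m \<and> qlinear \<eta> \<and>
    (\<forall>a b c. m (m a b) c = m a (m b c)) \<and>
    (\<forall>a. m (\<eta> 1) a = a \<and> m a (\<eta> 1) = a)"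

definition coalgebra_axioms :: "('a::rat_vector \<Rightarrow> ('a, 'a) tensor) \<Rightarrow> ('a \<Rightarrow> rat) \<Rightarrow> bool"
  where "coalgebra_axioms \<Delta> \<epsilon> \<longleftrightarrow>
    qlinear \<Delta> \<and> qlinear \<epsilon> \<and>
    (\<forall>a. tassoc (tmap \<Delta> id (\<Delta> a)) = tmap id \<Delta> (\<Delta> a)) \<and>
    (\<forall>a. tlift (\<lambda>x y. \<epsilon> x *\<^sub>Q y) (\<Delta> a) = a \<and> tlift (\<lambda>x y. \<epsilon> y *\<^sub>Q x) (\<Delta> a) = a)"

definition bialgebra :: "('a::rat_vector \<Rightarrow> 'a \<Rightarrow> 'a) \<Rightarrow> (rat \<Rightarrow> 'a)
    \<Rightarrow> ('a \<Rightarrow> ('a, 'a) tensor) \<Rightarrow> ('a \<Rightarrow> rat) \<Rightarrow> bool"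
  where "bialgebra m \<eta> \<Delta> \<epsilon> \<longleftrightarrow>
    algebra_axioms m \<eta> \<and> coalgebra_axioms \<Delta> \<epsilon> \<and>
    (\<forall>a b. \<Delta> (m a b) = tmult m m (\<Delta> a) (\<Delta> b)) \<and> \<Delta> (\<eta> 1) = \<eta> 1 \<otimes> \<eta> 1 \<and>
    (\<forall>a b. \<epsilon> (m a b) = \<epsilon> a * \<epsilon> b) \<and> \<epsilon> (\<eta> 1) = 1"

definition antipode :: "('a::rat_vector \<Rightarrow> 'a \<Rightarrow> 'a) \<Rightarrow> (rat \<Rightarrow> 'a)
    \<Rightarrow> ('a \<Rightarrow> ('a, 'a) tensor) \<Rightarrow> ('a \<Rightarrow> rat) \<Rightarrow> ('a \<Rightarrow> 'a) \<Rightarrow> bool"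
  where "antipode m \<eta> \<Delta> \<epsilon> S \<longleftrightarrow>
    qlinear S \<and>
    (\<forall>a. tlift m (tmap S id (\<Delta> a)) = \<eta> (\<epsilon> a) \<and> tlift m (tmap id S (\<Delta> a)) = \<eta> (\<epsilon> a))"

definition hopf_algebra :: "('a::rat_vector \<Rightarrow> 'a \<Rightarrow> 'a) \<Rightarrow> (rat \<Rightarrow> 'a)
    \<Rightarrow> ('a \<Rightarrow> ('a, 'a) tensor) \<Rightarrow> ('a \<Rightarrow> rat) \<Rightarrow> bool"
  where "hopf_algebra m \<eta> \<Delta> \<epsilon> \<longleftrightarrow> bialgebra m \<eta> \<Delta> \<epsilon> \<and> (\<exists>S. antipode m \<eta> \<Delta> \<epsilon> S)"


section \<open>The free associative algebra on two letters\<close>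

text \<open>The convolution product of \<^typ>\<open>'a \<Rightarrow>\<^sub>0 'b\<close> expects an additively written monoid, so
  the free monoid of lists is written additively here.\<close>

instantiation list :: (type) monoid_add
begin
definition zero_list :: "'a list" where [simp]: "zero_list = []"
definition plus_list :: "'a list \<Rightarrow> 'a list \<Rightarrow> 'a list" where [simp]: "plus_list = (@)"
instance by standard simp_all
end

datatype letter = Ld | Ly

type_synonym word = "letter list"
type_synonym free_alg = "word \<Rightarrow>\<^sub>0 rat"

abbreviation word :: "word \<Rightarrow> free_alg" where "word w \<equiv> Poly_Mapping.single w 1"

lemma word_mult: "word u * word v = word (u @ v)"
  by (simp add: Poly_Mapping.mult_single)

lemma word_Nil: "word [] = 1"
  by (metis Poly_Mapping.single_one zero_list_def)

lemma scaleQ_mult_left: "(c *\<^sub>Q p) * q = c *\<^sub>Q (p * q :: free_alg)"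
proof -
  have s: "c *\<^sub>Q p = Poly_Mapping.single 0 c * p" for p :: free_alg
    by (subst Poly_Mapping.mult_map_scale_conv_mult[symmetric])
       (auto intro!: poly_mapping_eqI simp: Poly_Mapping.map.rep_eq when_def)
  show ?thesis by (simp only: s mult.assoc)
qed

lemma scaleQ_mult_right: "p * (c *\<^sub>Q q) = c *\<^sub>Q (p * q :: free_alg)"
proof -
  have "qlinear (\<lambda>p. p * (c *\<^sub>Q q))" "qlinear (\<lambda>p. c *\<^sub>Q (p * q))" for q :: free_alg
    by (auto intro!: qlinearI simp: distrib_right scaleQ_mult_left scaleQ_add_right mult.commute)
  moreover have "word u * (c *\<^sub>Q q) = c *\<^sub>Q (word u * q)" for u
  proof (rule free_linear_ext[where p = q])
    show "qlinear (\<lambda>q. word u * (c *\<^sub>Q q))" "qlinear (\<lambda>q. c *\<^sub>Q (word u * q))"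
    proof -
      have *: "word u * (c *\<^sub>Q q) = c *\<^sub>Q (word u * q)" for c and q :: free_alg
      proof -
        have 1: "c *\<^sub>Q p = Poly_Mapping.single 0 c * p" for p :: free_alg
          by (subst Poly_Mapping.mult_map_scale_conv_mult[symmetric])
             (auto intro!: poly_mapping_eqI simp: Poly_Mapping.map.rep_eq when_def)
        show ?thesis unfolding 1 by (simp add: mult.assoc[symmetric] Poly_Mapping.mult_single)
      qed
      show "qlinear (\<lambda>q. word u * (c *\<^sub>Q q))" "qlinear (\<lambda>q. c *\<^sub>Q (word u * q))"
        by (auto intro!: qlinearI simp: * distrib_left scaleQ_add_right mult.commute)
    qed
    show "word u * (c *\<^sub>Q word v) = c *\<^sub>Q (word u * word v)" for v
    proof -
      have "c *\<^sub>Q word w = Poly_Mapping.single w c" for w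
        by (rule poly_mapping_eqI) (simp add: Poly_Mapping.lookup_single when_def)
      then show ?thesis by (simp add: Poly_Mapping.mult_single)
    qed
  qed
  ultimately show ?thesis by (rule free_linear_ext)
qed

lemma qbilinear_times: "qbilinear ((*) :: free_alg \<Rightarrow> free_alg \<Rightarrow> free_alg)"
  by (intro qbilinearI) (simp_all add: distrib_left distrib_right scaleQ_mult_left scaleQ_mult_right)


subsection \<open>The product\<close>

text \<open>The equations below are a deterministic selection from the recursive rules; \<open>diamond_P1\<close>,
  \<open>diamond_P2\<close> and \<open>diamond_P3\<close> state the rules in full.\<close>

fun diamond_word :: "rat \<Rightarrow> word \<Rightarrow> word \<Rightarrow> free_alg" where
  "diamond_word l [] v = word v"
| "diamond_word l (Ly # u) v = word [Ly] * diamond_word l u v"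
| "diamond_word l (Ld # u) [] = word (Ld # u)"
| "diamond_word l (Ld # u) (Ly # v) = word [Ly] * diamond_word l (Ld # u) v"
| "diamond_word l (Ld # u) (Ld # v) = (1 / l) *\<^sub>Q
     (word [Ld] * diamond_word l u v - diamond_word l (Ld # u) v - diamond_word l u (Ld # v))"

definition diamond :: "rat \<Rightarrow> free_alg \<Rightarrow> free_alg \<Rightarrow> free_alg"
  where "diamond l p q = lin_ext (\<lambda>u. lin_ext (\<lambda>v. diamond_word l u v) q) p"

lemma diamond_word_Nil_right: "diamond_word l u [] = word u"
proof (induction u)
  case (Cons a u)
  then show ?case by (cases a) (simp_all add: word_mult)
qed simp

lemma diamond_word_y_right: "diamond_word l u (Ly # v) = word [Ly] * diamond_word l u v"
proof (induction u)
  case (Cons a u)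
  then show ?case by (cases a) simp_all
qed (simp add: word_mult)

lemma diamond_word [simp]: "diamond l (word u) (word v) = diamond_word l u v"
  by (simp add: diamond_def scaleQ_one)

lemma qbilinear_diamond: "qbilinear (diamond l)"
  by (intro qbilinearI)
     (simp_all add: diamond_def qlinear_add[OF qlinear_lin_ext] qlinear_scale[OF qlinear_lin_ext],
      simp_all add: lin_ext_def scaleQ_add_right sum.distrib rat_vector.scale_sum_right mult.left_commute)

lemma diamond_P1: "diamond l (word []) (word w) = word w" "diamond l (word w) (word []) = word w"
  by (simp_all add: diamond_word_Nil_right)

lemma diamond_P2:
  "diamond l (word (Ly # u)) (word v) = word [Ly] * diamond l (word u) (word v)"
  "diamond l (word u) (word (Ly # v)) = word [Ly] * diamond l (word u) (word v)"
  by (simp_all add: diamond_word_y_right)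

lemma diamond_P3:
  "diamond l (word (Ld # u)) (word (Ld # v)) = (1 / l) *\<^sub>Q
     (word [Ld] * diamond l (word u) (word v) - diamond l (word (Ld # u)) (word v)
       - diamond l (word u) (word (Ld # v)))"
  by simp


subsection \<open>The coproduct and the counit\<close>

fun Delta_letter :: "rat \<Rightarrow> letter \<Rightarrow> (free_alg, free_alg) tensor" where
  "Delta_letter l Ly = 1 \<otimes> word [Ly] + word [Ly] \<otimes> 1"
| "Delta_letter l Ld = 1 \<otimes> word [Ld] + word [Ld] \<otimes> 1 + l *\<^sub>Q (word [Ld] \<otimes> word [Ld])"

fun Delta_word :: "rat \<Rightarrow> word \<Rightarrow> (free_alg, free_alg) tensor" where
  "Delta_word l [] = 1 \<otimes> 1"
| "Delta_word l (x # w) = tmult (*) (*) (Delta_letter l x) (Delta_word l w)"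

definition Delta_bar :: "rat \<Rightarrow> free_alg \<Rightarrow> (free_alg, free_alg) tensor"
  where "Delta_bar l = lin_ext (Delta_word l)"

lemma Delta_bar_word [simp]: "Delta_bar l (word w) = Delta_word l w"
  by (simp add: Delta_bar_def scaleQ_one)

abbreviation tmul :: "(free_alg, free_alg) tensor \<Rightarrow> (free_alg, free_alg) tensor
    \<Rightarrow> (free_alg, free_alg) tensor"
  where "tmul \<equiv> tmult (*) (*)"

lemmas qbilinear_tmul = qbilinear_tmult[OF qbilinear_times qbilinear_times]
lemmas tmul_tensor = tmult_tensor[OF qbilinear_times qbilinear_times]
lemmas tmul_simps = qbilinearD[OF qbilinear_tmul]

lemma tmul_one: "tmul (1 \<otimes> 1) t = t" "tmul t (1 \<otimes> 1) = t"
  by (rule tlift_unique[where t = t];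
      auto intro!: qlinearI simp: tmul_simps tmul_tensor)+

lemma tmul_assoc: "tmul (tmul r s) t = tmul r (tmul s t)"
proof -
  have 1: "tmul (tmul (a \<otimes> b) (a' \<otimes> b')) t = tmul (a \<otimes> b) (tmul (a' \<otimes> b') t)" for a b a' b' t
    by (rule tlift_unique[where t = t];
        auto intro!: qlinearI simp: tmul_simps tmul_tensor mult.assoc)
  have 2: "tmul (tmul (a \<otimes> b) s) t = tmul (a \<otimes> b) (tmul s t)" for a b s t
    by (rule tlift_unique[where t = s]) (rule qlinearI | simp add: tmul_simps 1)+
  show ?thesis
    by (rule tlift_unique[where t = r]) (rule qlinearI | simp add: tmul_simps 2)+
qed

text \<open>\<open>Delta_bar l\<close> is a morphism of unital algebras with the prescribed values on letters.\<close>

lemma Delta_bar_letter: "Delta_bar l (word [x]) = Delta_letter l x"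
  by (simp add: tmul_one)

lemma Delta_bar_one: "Delta_bar l 1 = 1 \<otimes> 1"
  by (simp flip: word_Nil)

lemma Delta_word_append: "Delta_word l (u @ v) = tmul (Delta_word l u) (Delta_word l v)"
  by (induction u) (simp_all add: tmul_one tmul_assoc)

lemma qlinear_Delta_bar: "qlinear (Delta_bar l)"
  unfolding Delta_bar_def by (rule qlinear_lin_ext)

lemma Delta_bar_mult: "Delta_bar l (p * q) = tmul (Delta_bar l p) (Delta_bar l q)"
proof -
  note s = qlinear_add[OF qlinear_Delta_bar] qlinear_scale[OF qlinear_Delta_bar] tmul_simps
    distrib_left distrib_right scaleQ_mult_left scaleQ_mult_right
  have 1: "Delta_bar l (word u * q) = tmul (Delta_bar l (word u)) (Delta_bar l q)" for u
    by (rule free_linear_ext[where p = q])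
       (auto intro!: qlinearI simp del: Delta_bar_word Delta_word.simps simp: s,
        simp add: word_mult Delta_word_append)
  show ?thesis
  proof (rule free_linear_ext[where p = p])
    show "qlinear (\<lambda>p. Delta_bar l (p * q))" "qlinear (\<lambda>p. tmul (Delta_bar l p) (Delta_bar l q))"
      by (rule qlinearI; simp add: s)+
  qed (rule 1)
qed

definition eta :: "rat \<Rightarrow> free_alg"
  where "eta c = c *\<^sub>Q word []"

definition eps :: "free_alg \<Rightarrow> rat"
  where "eps = lin_ext (\<lambda>w. if w = [] then 1 else 0)"


section \<open>The quotient by the words ending in \<open>d\<close>\<close>

definition T_minus :: "free_alg set"
  where "T_minus = rat_vector.span {word (w @ [Ld]) | w. True}"

definition Y :: "word set"
  where "Y = {w @ [Ly] | w. True} \<union> {[]}"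

quotient_type H = free_alg / "\<lambda>p q. p - q \<in> T_minus"
  unfolding T_minus_def by (rule equivp_span)

definition proj :: "free_alg \<Rightarrow> H" where "proj = abs_H"

instantiation H :: rat_vector
begin

lift_definition zero_H :: H is 0 .

lift_definition plus_H :: "H \<Rightarrow> H \<Rightarrow> H" is "(+)"
  unfolding T_minus_def by (rule span_congs(1))

lift_definition minus_H :: "H \<Rightarrow> H \<Rightarrow> H" is "(-)"
  unfolding T_minus_def by (rule span_congs(2))

lift_definition uminus_H :: "H \<Rightarrow> H" is uminus
  unfolding T_minus_def by (rule span_congs(3))

lift_definition scaleQ_H :: "rat \<Rightarrow> H \<Rightarrow> H" is scaleQ
  unfolding T_minus_def by (rule span_congs(4))

instance
proof
  fix u v w :: "H" and a b :: rat
  note eqs = zero_H_def plus_H.abs_eq minus_H.abs_eq uminus_H.abs_eq scaleQ_H.abs_eq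
  show "u + v + w = u + (v + w)"
    by (induction u; induction v; induction w) (simp add: eqs add.assoc)
  show "u + v = v + u"
    by (induction u; induction v) (simp add: eqs add.commute)
  show "0 + u = u" "- u + u = 0"
    by (induction u; simp add: eqs)+
  show "u - v = u + - v"
    by (induction u; induction v) (simp add: eqs)
  show "a *\<^sub>Q (u + v) = a *\<^sub>Q u + a *\<^sub>Q v"
    by (induction u; induction v) (simp add: eqs scaleQ_add_right)
  show "(a + b) *\<^sub>Q u = a *\<^sub>Q u + b *\<^sub>Q u" "a *\<^sub>Q b *\<^sub>Q u = (a * b) *\<^sub>Q u" "1 *\<^sub>Q u = u"
    by (induction u; simp add: eqs scaleQ_add_left)+
qed

end

lemma proj_eq_iff: "proj p = proj q \<longleftrightarrow> p - q \<in> T_minus"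
  by (simp add: proj_def H.abs_eq_iff)

lemma proj_surj: "\<exists>p. h = proj p"
  by (induction h) (auto simp: proj_def)

lemma qlinear_proj: "qlinear proj"
  by (rule qlinearI) (simp_all add: proj_def plus_H.abs_eq scaleQ_H.abs_eq)

lemma proj_T_minus: "p \<in> T_minus \<Longrightarrow> proj p = 0"
  using proj_eq_iff[of p 0] by (simp add: qlinear_zero[OF qlinear_proj])

subsection \<open>Identification with the span of \<open>Y\<close>\<close>

definition restrict_Y :: "free_alg \<Rightarrow> free_alg"
  where "restrict_Y = lin_ext (\<lambda>w. if w \<in> Y then word w else 0)"

lemma qlinear_restrict_Y: "qlinear restrict_Y"
  unfolding restrict_Y_def by (rule qlinear_lin_ext)

lemma restrict_Y_T_minus: "p \<in> T_minus \<Longrightarrow> restrict_Y p = 0"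
  unfolding T_minus_def
  by (rule qlinear_eq_0_on_span[OF qlinear_restrict_Y]) (auto simp: restrict_Y_def Y_def)

lemma restrict_Y_diff: "restrict_Y p - p \<in> T_minus"
proof -
  have w: "restrict_Y (word w) - word w \<in> T_minus" for w
  proof (cases "w \<in> Y")
    case True
    then show ?thesis by (simp add: restrict_Y_def T_minus_def scaleQ_one rat_vector.span_zero)
  next
    case False
    then obtain v where "w = v @ [Ld]"
      unfolding Y_def by (cases w rule: rev_cases) (auto intro: letter.exhaust)
    then have "word w \<in> T_minus"
      by (auto simp: T_minus_def intro: rat_vector.span_base)
    with False show ?thesis
      by (simp add: restrict_Y_def T_minus_def rat_vector.span_neg)
  qed
  have lin: "qlinear (\<lambda>p. proj (restrict_Y p))"
    by (rule qlinear_comp[OF qlinear_restrict_Y qlinear_proj])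
  have "proj (restrict_Y p) = proj p"
    by (rule free_linear_ext[OF lin qlinear_proj]) (simp add: proj_eq_iff w)
  then show ?thesis by (simp add: proj_eq_iff)
qed

text \<open>The representative of a residue class that is a combination of words in \<open>Y\<close>.\<close>

lift_definition Yrep :: "H \<Rightarrow> free_alg" is restrict_Y
  using restrict_Y_T_minus by (fastforce simp: qlinear_diff[OF qlinear_restrict_Y])

lemma Yrep_proj: "Yrep (proj p) = restrict_Y p"
  by (simp add: proj_def Yrep.abs_eq)

lemma proj_Yrep: "proj (Yrep h) = h"
  using proj_surj[of h] by (auto simp: Yrep_proj proj_eq_iff restrict_Y_diff)

lemma restrict_Y_word: "w \<in> Y \<Longrightarrow> restrict_Y (word w) = word w"
  by (simp add: restrict_Y_def scaleQ_one)

lemma bij_betw_proj_Y: "bij_betw proj (rat_vector.span (word ` Y)) UNIV"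
proof (rule bij_betw_byWitness[where f' = Yrep])
  have "Yrep h \<in> rat_vector.span (word ` Y)" for h
  proof -
    obtain p where "h = proj p" using proj_surj by blast
    moreover have "(if w \<in> Y then word w else 0) \<in> rat_vector.span (word ` Y)" for w
      by (auto intro: rat_vector.span_base rat_vector.span_zero)
    ultimately show ?thesis
      by (simp only: Yrep_proj restrict_Y_def lin_ext_def rat_vector.span_sum rat_vector.span_scale)
  qed
  then show "Yrep ` UNIV \<subseteq> rat_vector.span (word ` Y)" by blast
  have "Yrep (proj p) = p" if "p \<in> rat_vector.span (word ` Y)" for p
    using that unfolding Yrep_proj
    by (induction rule: rat_vector.span_induct_alt)
       (auto simp: qlinear_zero[OF qlinear_restrict_Y] qlinear_add[OF qlinear_restrict_Y]
          qlinear_scale[OF qlinear_restrict_Y] restrict_Y_word)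
  then show "\<forall>p\<in>rat_vector.span (word ` Y). Yrep (proj p) = p" by blast
qed (simp_all add: proj_Yrep)

text \<open>The map \<open>tmap proj proj\<close> is reduction modulo
  \<open>T_minus \<otimes> \<rat>\<langle>L\<rangle> + \<rat>\<langle>L\<rangle> \<otimes> T_minus\<close>.\<close>

lemma tmap_proj_eq_iff:
  "tmap proj proj s = tmap proj proj t \<longleftrightarrow>
   s - t \<in> rat_vector.span ({p \<otimes> q | p q. p \<in> T_minus} \<union> {p \<otimes> q | p q. q \<in> T_minus})"
  (is "_ \<longleftrightarrow> _ \<in> rat_vector.span ?K")
proof -
  note lin = qlinear_tmap[OF qlinear_proj qlinear_proj]
  note rr = qlinear_tmap[OF qlinear_restrict_Y qlinear_restrict_Y]
  have qYrep: "qlinear Yrep"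
  proof (rule qlinearI)
    show "Yrep (x + x') = Yrep x + Yrep x'" for x x'
      using proj_surj[of x] proj_surj[of x']
      by (auto simp: Yrep_proj qlinear_add[OF qlinear_restrict_Y]
          simp flip: qlinear_add[OF qlinear_proj])
    show "Yrep (c *\<^sub>Q x) = c *\<^sub>Q Yrep x" for c x
      using proj_surj[of x]
      by (auto simp: Yrep_proj qlinear_scale[OF qlinear_restrict_Y]
          simp flip: qlinear_scale[OF qlinear_proj])
  qed
  have sect: "tmap Yrep Yrep (tmap proj proj u) = tmap restrict_Y restrict_Y u" for u
    by (rule tlift_unique[OF qlinear_comp[OF lin qlinear_tmap[OF qYrep qYrep]] rr])
       (simp add: tmap_tensor qlinear_proj qYrep qlinear_restrict_Y Yrep_proj)
  have diff: "tmap restrict_Y restrict_Y u - u \<in> rat_vector.span ?K" for u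
  proof -
    have pure: "tmap restrict_Y restrict_Y (p \<otimes> q) - p \<otimes> q \<in> rat_vector.span ?K" for p q
    proof -
      have "tmap restrict_Y restrict_Y (p \<otimes> q) - p \<otimes> q
          = (restrict_Y p - p) \<otimes> restrict_Y q + p \<otimes> (restrict_Y q - q)"
        by (simp add: tmap_tensor qlinear_restrict_Y qbilinearD[OF qbilinear_tensor])
      also have "\<dots> \<in> rat_vector.span ?K"
        using restrict_Y_diff by (intro rat_vector.span_add rat_vector.span_base) blast+
      finally show ?thesis .
    qed
    let ?g = "\<lambda>u. tmap restrict_Y restrict_Y u - u"
    have "qlinear ?g"
      by (rule qlinearI)
        (simp_all add: qlinear_add[OF rr] qlinear_scale[OF rr] rat_vector.scale_right_diff_distrib)
    from lin_ext_cong_qlinear[OF this, of "\<lambda>x. fst x \<otimes> snd x" "rep_tensor u"]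
    have "?g u = lin_ext (\<lambda>x. ?g (fst x \<otimes> snd x)) (rep_tensor u)"
      unfolding tensor_expand[of u, symmetric, unfolded case_prod_unfold] .
    also have "\<dots> \<in> rat_vector.span ?K"
      unfolding lin_ext_def by (intro rat_vector.span_sum rat_vector.span_scale pure)
    finally show ?thesis .
  qed
  show ?thesis
  proof
    assume "tmap proj proj s = tmap proj proj t"
    then have "tmap restrict_Y restrict_Y (s - t) = 0"
      by (metis sect qlinear_diff[OF rr] diff_self)
    with diff[of "s - t"] have "- (s - t) \<in> rat_vector.span ?K" by simp
    then show "s - t \<in> rat_vector.span ?K"
      using rat_vector.span_neg by fastforce
  next
    assume "s - t \<in> rat_vector.span ?K"
    then have "tmap proj proj (s - t) = 0"
      by (rule qlinear_eq_0_on_span[OF lin, rotated])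
         (auto simp: tmap_tensor qlinear_proj proj_T_minus qbilinearD[OF qbilinear_tensor])
    then show "tmap proj proj s = tmap proj proj t"
      by (simp add: qlinear_diff[OF lin])
  qed
qed


subsection \<open>The induced structure maps\<close>

lemma T_minus_closed:
  "p \<in> T_minus \<Longrightarrow> q \<in> T_minus \<Longrightarrow> p + q \<in> T_minus"
  "p \<in> T_minus \<Longrightarrow> q \<in> T_minus \<Longrightarrow> p - q \<in> T_minus"
  "p \<in> T_minus \<Longrightarrow> c *\<^sub>Q p \<in> T_minus"
  "p \<in> T_minus \<Longrightarrow> - p \<in> T_minus"
  unfolding T_minus_def
  by (rule rat_vector.span_neg rat_vector.span_add rat_vector.span_diff rat_vector.span_scale; assumption)+

lemma T_minus_word: "word (w @ [Ld]) \<in> T_minus"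
  unfolding T_minus_def by (rule rat_vector.span_base) blast

lemma T_minus_mult: "p \<in> T_minus \<Longrightarrow> q * p \<in> T_minus"
proof -
  assume p: "p \<in> T_minus"
  have lin: "qlinear (\<lambda>p. proj (q * p))" for q
    by (rule qlinear_comp[OF _ qlinear_proj]) (use qbilinear_times in \<open>simp add: qbilinear_def\<close>)
  have "proj (word u * word (w @ [Ld])) = 0" for u w
    unfolding word_mult append_assoc[symmetric] by (rule proj_T_minus[OF T_minus_word])
  moreover have lin': "qlinear (\<lambda>q. proj (q * p))" for p
    by (rule qlinear_comp[OF _ qlinear_proj]) (use qbilinear_times in \<open>simp add: qbilinear_def\<close>)
  ultimately have w: "proj (q * word (w @ [Ld])) = 0" for w
    using free_linear_ext[OF lin' qlinear_zero_map] by blast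
  have "proj (q * p) = 0"
    by (rule qlinear_eq_0_on_span[OF lin _ p[unfolded T_minus_def]]) (auto simp only: w)
  then show "q * p \<in> T_minus"
    using proj_eq_iff[of "q * p" 0] by (simp add: qlinear_zero[OF qlinear_proj])
qed

lemma Y_simps: "[] \<in> Y" "Ly # u \<in> Y \<longleftrightarrow> u \<in> Y" "Ld # u \<in> Y \<longleftrightarrow> u \<noteq> [] \<and> u \<in> Y"
  by (auto simp: Y_def Cons_eq_append_conv)

lemma word_T_minus: "w \<notin> Y \<Longrightarrow> word w \<in> T_minus"
  unfolding Y_def by (cases w rule: rev_cases) (auto, metis T_minus_word letter.exhaust)

lemma diamond_word_T_minus:
  "u \<notin> Y \<or> v \<notin> Y \<Longrightarrow> diamond_word l u v \<in> T_minus"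
proof (induction l u v rule: diamond_word.induct)
  case (5 l u v)
  consider "u = []" | "v = []" | "u \<noteq> []" "v \<noteq> []" by blast
  then show ?case
  proof cases
    case 1
    then have "diamond_word l (Ld # u) (Ld # v) = (1 / l) *\<^sub>Q (- diamond_word l [Ld] v)"
      by (simp add: word_mult)
    moreover have "diamond_word l [Ld] v \<in> T_minus"
      using 5(2) 1 by (simp add: Y_simps)
    ultimately show ?thesis by (simp only: T_minus_closed)
  next
    case 2
    then have "diamond_word l (Ld # u) (Ld # v) = (1 / l) *\<^sub>Q (- diamond_word l u [Ld])"
      by (simp add: word_mult diamond_word_Nil_right)
    moreover have "diamond_word l u [Ld] \<in> T_minus"
      using 5(3) 2 by (simp add: Y_simps)
    ultimately show ?thesis by (simp only: T_minus_closed)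
  next
    case 3
    then show ?thesis
      using 5 by (auto simp: Y_simps intro!: T_minus_closed(2,3) T_minus_mult)
  qed
qed (auto simp: Y_simps word_T_minus intro!: T_minus_mult)

lemma diamond_T_minus:
  assumes "p \<in> T_minus"
  shows "diamond l p q \<in> T_minus" "diamond l q p \<in> T_minus"
proof -
  have lin: "qlinear (\<lambda>p. proj (diamond l p q))" "qlinear (\<lambda>p. proj (diamond l q p))" for q
    by (rule qlinear_comp[OF _ qlinear_proj],
        use qbilinear_diamond[of l] in \<open>simp add: qbilinear_def\<close>)+
  have Tw: "w @ [Ld] \<notin> Y" for w by (simp add: Y_def)
  have w: "proj (diamond l (word (w @ [Ld])) q) = 0" for w
    by (rule free_linear_ext[OF lin(2) qlinear_zero_map])
       (simp add: proj_T_minus diamond_word_T_minus Tw)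
  have w': "proj (diamond l q (word (w @ [Ld]))) = 0" for w
    by (rule free_linear_ext[OF lin(1) qlinear_zero_map])
       (simp add: proj_T_minus diamond_word_T_minus Tw)
  have "proj (diamond l p q) = 0"
    by (rule qlinear_eq_0_on_span[OF lin(1) _ assms[unfolded T_minus_def]]) (auto simp only: w)
  moreover have "proj (diamond l q p) = 0"
    by (rule qlinear_eq_0_on_span[OF lin(2) _ assms[unfolded T_minus_def]]) (auto simp only: w')
  ultimately show "diamond l p q \<in> T_minus" "diamond l q p \<in> T_minus"
    using proj_eq_iff[of _ 0] by (simp_all add: qlinear_zero[OF qlinear_proj])
qed

lift_definition diamond_H :: "rat \<Rightarrow> H \<Rightarrow> H \<Rightarrow> H" is diamond
proof -
  fix l and p p' q q' :: free_alg
  assume "p - p' \<in> T_minus" "q - q' \<in> T_minus"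
  then have "diamond l (p - p') q + diamond l p' (q - q') \<in> T_minus"
    by (simp only: T_minus_closed(1) diamond_T_minus)
  then show "diamond l p q - diamond l p' q' \<in> T_minus"
    by (simp add: qbilinearD[OF qbilinear_diamond])
qed

definition eta_H :: "rat \<Rightarrow> H"
  where "eta_H c = proj (eta c)"

lemma qlinear_eps: "qlinear eps"
  unfolding eps_def by (rule qlinear_lin_ext)

lemma eps_T_minus: "p \<in> T_minus \<Longrightarrow> eps p = 0"
  unfolding T_minus_def by (rule qlinear_eq_0_on_span[OF qlinear_eps]) (auto simp: eps_def)

lift_definition eps_H :: "H \<Rightarrow> rat" is eps
  using eps_T_minus by (fastforce simp: qlinear_diff[OF qlinear_eps])

definition Delta_H :: "rat \<Rightarrow> H \<Rightarrow> (H, H) tensor"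
  where "Delta_H l h = tmap proj proj (Delta_bar l (Yrep h))"

lemma diamond_H_proj: "diamond_H l (proj p) (proj q) = proj (diamond l p q)"
  by (simp add: proj_def diamond_H.abs_eq)

lemma eps_H_proj: "eps_H (proj p) = eps p"
  by (simp add: proj_def eps_H.abs_eq)

lemma Delta_H_word: "w \<in> Y \<Longrightarrow> Delta_H l (proj (word w)) = tmap proj proj (Delta_bar l (word w))"
  by (simp only: Delta_H_def Yrep_proj restrict_Y_word)

end

theory Submission
  imports Defs
begin

text \<open>
  Put \<open>\<sigma> = 1 + \<lambda>d\<close>, an invertible change of letters since \<open>\<lambda> \<noteq> 0\<close>.  In these letters the
  structure becomes transparent.  Rule (P3) becomes
  \<open>\<sigma>u \<diamondop> \<sigma>v = \<sigma>(u \<diamondop> v)\<close>; rule (P2) says that prefixing \<open>y\<close> is \<open>\<diamondop>\<close>-multiplication by \<open>y\<close>; and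
  \<open>\<Delta>(\<sigma>) = \<sigma> \<otimes> \<sigma>\<close> is grouplike while \<open>y\<close> is primitive.  Modulo words ending in \<open>d\<close> moreover
  \<open>\<sigma>1 = 1\<close>.  So \<open>\<H>\<close> is the polynomial algebra in the elements \<open>y(n) = \<sigma>\<^sup>n y\<close>: the word
  \<open>\<sigma>\<^sup>i y \<sigma>\<^sup>j y \<sigma>\<^sup>k y \<dots>\<close> is the monomial \<open>y(i) \<diamondop> y(i + j) \<diamondop> y(i + j + k) \<diamondop> \<dots>\<close>, and \<open>\<Delta>\<close> is the
  algebra morphism that makes every \<open>y(n)\<close> primitive.

  The proof does not build this isomorphism.  It uses only that \<open>\<H>\<close> is spanned by what the two
  operators ``prefix \<open>y\<close>'' and ``prefix \<open>\<sigma>\<close>'' produce from \<open>1\<close> (\<open>span_ys_word\<close>), together with the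
  way each structure map commutes with them:
  \<open>diamond_H_ymul\<close> and \<open>diamond_H_sigma\<close> for the product, \<open>Delta_H_ymul\<close> and \<open>Delta_H_sigma\<close>
  for the coproduct, and \<open>eps_H_letter\<close>, \<open>eps_H_sigma\<close> for the counit.  Each Hopf algebra axiom equates
  two linear or bilinear maps; both sides transform in the same way under the operators and agree
  at \<open>1\<close>, so they agree (\<open>linear_eq_by_letters\<close>, \<open>bilinear_eq_by_letters\<close>).  The antipode reverses
  the sign of \<open>y\<close> and fixes \<open>\<sigma>\<close>, and therefore multiplies a word by \<open>-1\<close> for every \<open>y\<close> in it.
\<close>

section \<open>Bilinear maps on free modules and tensor products\<close>

lemma free_bilinear_ext:
  fixes f g :: "('x \<Rightarrow>\<^sub>0 rat) \<Rightarrow> ('y \<Rightarrow>\<^sub>0 rat) \<Rightarrow> 'c::rat_vector"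
  assumes "qbilinear f" "qbilinear g"
    and "\<And>x y. f (Poly_Mapping.single x 1) (Poly_Mapping.single y 1)
      = g (Poly_Mapping.single x 1) (Poly_Mapping.single y 1)"
  shows "f p q = g p q"
proof -
  have "f (Poly_Mapping.single x 1) q = g (Poly_Mapping.single x 1) q" for x
    by (rule free_linear_ext[where p = q]) (use assms in \<open>auto simp: qbilinear_def\<close>)
  then show ?thesis
    by (rule free_linear_ext[where p = p, rotated 2])
      (use assms in \<open>auto simp: qbilinear_def\<close>)
qed

lemma tensor_bilinear_ext:
  assumes "qbilinear f" "qbilinear g"
    and "\<And>a b a' b'. f (a \<otimes> b) (a' \<otimes> b') = g (a \<otimes> b) (a' \<otimes> b')"
  shows "f s t = g s t"
proof -
  have "f (a \<otimes> b) t = g (a \<otimes> b) t" for a b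
    by (rule tlift_unique[where t = t]) (use assms in \<open>auto simp: qbilinear_def\<close>)
  then show ?thesis
    by (rule tlift_unique[where t = s, rotated 2]) (use assms in \<open>auto simp: qbilinear_def\<close>)
qed


section \<open>Left multiplication on the quotient\<close>

lift_definition lmul :: "free_alg \<Rightarrow> H \<Rightarrow> H" is "\<lambda>(q::free_alg) p. q * p"
proof -
  fix q p p' :: free_alg
  assume "p - p' \<in> T_minus"
  then have "q * (p - p') \<in> T_minus" by (rule T_minus_mult)
  then show "q * p - q * p' \<in> T_minus" by (simp add: right_diff_distrib)
qed

lemma lmul_proj: "lmul q (proj p) = proj (q * p)"
  by (simp add: proj_def lmul.abs_eq)

lemma proj_add: "proj (p + q) = proj p + proj q"
  and proj_scale: "proj (c *\<^sub>Q p) = c *\<^sub>Q proj p"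
  by (simp_all add: qlinear_add[OF qlinear_proj] qlinear_scale[OF qlinear_proj])

lemma qbilinear_lmul: "qbilinear lmul"
proof (rule qbilinearI)
  show "lmul (p + q) h = lmul p h + lmul q h" for p q h
    using proj_surj[of h] by (auto simp: lmul_proj distrib_right proj_add)
  show "lmul q (h + k) = lmul q h + lmul q k" for q h k
    using proj_surj[of h] proj_surj[of k]
    by (auto simp: lmul_proj distrib_left simp flip: proj_add)
  show "lmul (c *\<^sub>Q q) h = c *\<^sub>Q lmul q h" for c q h
    using proj_surj[of h] by (auto simp: lmul_proj scaleQ_mult_left proj_scale)
  show "lmul q (c *\<^sub>Q h) = c *\<^sub>Q lmul q h" for c q h
    using proj_surj[of h] by (auto simp: lmul_proj scaleQ_mult_right simp flip: proj_scale)
qed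

lemma qlinear_lmul: "qlinear (lmul q)"
  using qbilinear_lmul by (simp add: qbilinear_def)

abbreviation ymul :: "H \<Rightarrow> H" where "ymul \<equiv> lmul (word [Ly])"

definition sigma :: "rat \<Rightarrow> H \<Rightarrow> H"
  where "sigma l = lmul (1 + l *\<^sub>Q word [Ld])"

lemma qlinear_sigma: "qlinear (sigma l)"
  by (simp add: sigma_def qlinear_lmul)

lemmas ops_linear =
  qlinear_add[OF qlinear_lmul] qlinear_scale[OF qlinear_lmul]
  qlinear_add[OF qlinear_sigma] qlinear_scale[OF qlinear_sigma]

lemma sigma_eq: "sigma l h = h + l *\<^sub>Q lmul (word [Ld]) h"
proof -
  have "lmul 1 h = h" using proj_surj[of h] by (auto simp: lmul_proj)
  then show ?thesis by (simp add: sigma_def qbilinearD[OF qbilinear_lmul])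
qed

text \<open>The word \<open>d\<close> vanishes in the quotient.  This is what makes \<open>\<sigma>\<close> unital, and it is used for
  the antipode.\<close>

lemma sigma_one: "sigma l (proj 1) = proj 1"
  using proj_T_minus[OF T_minus_word[of "[]"]] by (simp add: sigma_eq lmul_proj)


section \<open>Induction over the operators \<open>y\<close> and \<open>\<sigma>\<close>\<close>

text \<open>Words in the letters \<open>y\<close> and \<open>\<sigma>\<close>; the letter \<open>Ld\<close> stands for \<open>\<sigma>\<close>.\<close>

fun ys_word :: "rat \<Rightarrow> word \<Rightarrow> H" where
  "ys_word l [] = proj 1"
| "ys_word l (Ly # w) = ymul (ys_word l w)"
| "ys_word l (Ld # w) = sigma l (ys_word l w)"

lemma word_induct:
  assumes "P []" "\<And>w. P w \<Longrightarrow> P (Ly # w)" "\<And>w. P w \<Longrightarrow> P (Ld # w)"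
  shows "P w"
proof (induction w)
  case (Cons x w)
  with assms show ?case by (cases x) auto
qed (rule assms)

text \<open>Here \<open>\<lambda> \<noteq> 0\<close> enters: \<open>d = (\<sigma> - 1) / \<lambda>\<close>, so the span of the words in \<open>y\<close> and \<open>\<sigma>\<close> is stable under
  prefixing \<open>y\<close> or \<open>d\<close>.\<close>

lemma span_ys_word:
  assumes "l \<noteq> 0"
  shows "h \<in> rat_vector.span (range (ys_word l))" (is "_ \<in> ?V")
proof -
  have "ymul h \<in> ?V \<and> sigma l h \<in> ?V" if "h \<in> ?V" for h
    using that
  proof (induction rule: rat_vector.span_induct_alt)
    case base
    then show ?case
      by (simp add: qlinear_zero[OF qlinear_lmul] qlinear_zero[OF qlinear_sigma] rat_vector.span_zero)
  next
    case (step c x z)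
    then obtain w where "x = ys_word l w" by blast
    then have "ymul x = ys_word l (Ly # w)" "sigma l x = ys_word l (Ld # w)" by simp_all
    then have "ymul x \<in> ?V" "sigma l x \<in> ?V"
      by (metis rangeI rat_vector.span_base)+
    with step show ?case
      by (simp add: ops_linear rat_vector.span_add rat_vector.span_scale)
  qed
  note closed = this
  have d: "lmul (word [Ld]) h \<in> ?V" if "h \<in> ?V" for h
  proof -
    have "lmul (word [Ld]) h = (1 / l) *\<^sub>Q (sigma l h - h)"
      using assms by (simp add: sigma_eq scaleQ_scaleQ scaleQ_one)
    then show ?thesis
      using closed that by (simp add: rat_vector.span_scale rat_vector.span_diff)
  qed
  have w: "proj (word w) \<in> ?V" for w
  proof (induction w)
    case Nil
    have "ys_word l [] \<in> ?V" by (intro rat_vector.span_base rangeI)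
    then show ?case by (simp add: word_Nil)
  next
    case (Cons x w)
    have "proj (word (x # w)) = lmul (word [x]) (proj (word w))"
      by (simp add: lmul_proj word_mult)
    with Cons d closed show ?case by (cases x) auto
  qed
  obtain p where "h = proj p" using proj_surj by blast
  also have "\<dots> = (\<Sum>w\<in>Poly_Mapping.keys p. Poly_Mapping.lookup p w *\<^sub>Q proj (word w))"
    by (subst free_expand) (simp add: qlinear_sum[OF qlinear_proj] proj_scale)
  also have "\<dots> \<in> ?V"
    by (intro rat_vector.span_sum rat_vector.span_scale w)
  finally show ?thesis .
qed

lemma linear_eq_on_ys_words:
  assumes "l \<noteq> 0" "qlinear f" "qlinear g" "\<And>w. f (ys_word l w) = g (ys_word l w)"
  shows "f h = g h"
  using span_ys_word[OF assms(1), of h]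
  by (induction rule: rat_vector.span_induct_alt)
    (auto simp: qlinear_zero[OF assms(2)] qlinear_zero[OF assms(3)]
      qlinear_add[OF assms(2)] qlinear_add[OF assms(3)]
      qlinear_scale[OF assms(2)] qlinear_scale[OF assms(3)] assms(4))

lemma linear_eq_by_letters:
  assumes "l \<noteq> 0" "qlinear f" "qlinear g" "f (proj 1) = g (proj 1)"
    and "\<And>h. f h = g h \<Longrightarrow> f (ymul h) = g (ymul h)"
    and "\<And>h. f h = g h \<Longrightarrow> f (sigma l h) = g (sigma l h)"
  shows "f h = g h"
proof (rule linear_eq_on_ys_words[OF assms(1-3)])
  show "f (ys_word l w) = g (ys_word l w)" for w
    by (induction w rule: word_induct) (simp_all add: assms)
qed

text \<open>Moving \<open>y\<close> out of either argument is always possible, whereas \<open>\<sigma>\<close> can be moved out only when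
  both arguments start with it.  Two words for which neither is possible include an empty one.\<close>

lemma bilinear_eq_by_letters:
  assumes "l \<noteq> 0" "qbilinear f" "qbilinear g"
    and one: "\<And>h. f (proj 1) h = g (proj 1) h" "\<And>h. f h (proj 1) = g h (proj 1)"
    and y: "\<And>a b. f a b = g a b \<Longrightarrow> f (ymul a) b = g (ymul a) b"
      "\<And>a b. f a b = g a b \<Longrightarrow> f a (ymul b) = g a (ymul b)"
    and s: "\<And>a b. f a b = g a b \<Longrightarrow> f (sigma l a) (sigma l b) = g (sigma l a) (sigma l b)"
  shows "f a b = g a b"
proof -
  have words: "f (ys_word l u) (ys_word l v) = g (ys_word l u) (ys_word l v)" for u v
    using s by (induction l u v rule: diamond_word.induct) (simp_all add: one y)
  have "f (ys_word l u) b = g (ys_word l u) b" for u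
    by (rule linear_eq_on_ys_words[where h = b, OF assms(1)])
      (use assms(2,3) words in \<open>auto simp: qbilinear_def\<close>)
  then show ?thesis
    by (rule linear_eq_on_ys_words[where h = a, OF assms(1), rotated 2])
      (use assms(2,3) in \<open>auto simp: qbilinear_def\<close>)
qed


section \<open>The product\<close>

lemma qbilinear_diamond_H: "qbilinear (diamond_H l)"
proof (rule qbilinearI)
  note s = diamond_H_proj qbilinearD[OF qbilinear_diamond]
  fix a b k :: H and c :: rat
  obtain p q r where "a = proj p" "b = proj q" "k = proj r"
    using proj_surj by metis
  then show "diamond_H l (a + b) k = diamond_H l a k + diamond_H l b k"
    "diamond_H l a (b + k) = diamond_H l a b + diamond_H l a k"
    "diamond_H l (c *\<^sub>Q a) b = c *\<^sub>Q diamond_H l a b"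
    "diamond_H l a (c *\<^sub>Q b) = c *\<^sub>Q diamond_H l a b"
    by (simp_all add: s flip: proj_add proj_scale)
qed

lemmas diamond_H_linear = qbilinearD[OF qbilinear_diamond_H]

lemma diamond_H_one: "diamond_H l (proj 1) h = h" "diamond_H l h (proj 1) = h"
proof -
  obtain p where p: "h = proj p" using proj_surj by blast
  have "diamond l (word []) p = p" "diamond l p (word []) = p"
    by (rule free_linear_ext[where p = p];
        auto intro!: qlinearI simp: qbilinearD[OF qbilinear_diamond] diamond_word_Nil_right)+
  then show "diamond_H l (proj 1) h = h" "diamond_H l h (proj 1) = h"
    by (simp_all add: p diamond_H_proj word_Nil)
qed

lemma diamond_H_ymul:
  "diamond_H l (ymul a) b = ymul (diamond_H l a b)"
  "diamond_H l a (ymul b) = ymul (diamond_H l a b)"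
proof -
  note s = qbilinearD[OF qbilinear_diamond] distrib_left scaleQ_mult_right
  obtain p q where "a = proj p" "b = proj q" using proj_surj by metis
  moreover have "diamond l (word [Ly] * p) q = word [Ly] * diamond l p q"
    by (rule free_bilinear_ext[where p = p and q = q])
      (auto intro!: qbilinearI simp: s word_mult)
  moreover have "diamond l p (word [Ly] * q) = word [Ly] * diamond l p q"
    by (rule free_bilinear_ext[where p = p and q = q])
      (auto intro!: qbilinearI simp: s word_mult diamond_word_y_right)
  ultimately show "diamond_H l (ymul a) b = ymul (diamond_H l a b)"
    "diamond_H l a (ymul b) = ymul (diamond_H l a b)"
    by (simp_all add: lmul_proj diamond_H_proj)
qed

text \<open>Rule (P3) is the \<open>\<lambda>\<close>-twisted Leibniz rule
  \<open>d(u \<diamondop> v) = du \<diamondop> v + u \<diamondop> dv + \<lambda> du \<diamondop> dv\<close> in disguise, and this is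
  equivalent to \<open>\<sigma> = 1 + \<lambda>d\<close> being multiplicative.\<close>

lemma diamond_H_sigma:
  assumes "l \<noteq> 0"
  shows "diamond_H l (sigma l a) (sigma l b) = sigma l (diamond_H l a b)"
proof -
  let ?d = "word [Ld]"
  note s = qbilinearD[OF qbilinear_diamond] distrib_left scaleQ_mult_right
    scaleQ_add_right rat_vector.scale_right_diff_distrib
  obtain p q where pq: "a = proj p" "b = proj q" using proj_surj by metis
  have "l *\<^sub>Q diamond l (?d * p) (?d * q) = ?d * diamond l p q - diamond l (?d * p) q - diamond l p (?d * q)"
    by (rule free_bilinear_ext[where p = p and q = q])
      (use assms in \<open>auto intro!: qbilinearI simp: s word_mult scaleQ_scaleQ scaleQ_one mult.commute\<close>)
  then have "diamond l (p + l *\<^sub>Q (?d * p)) (q + l *\<^sub>Q (?d * q))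
      = diamond l p q + l *\<^sub>Q (?d * diamond l p q)"
    by (simp add: s)
  then show ?thesis
    by (simp add: pq sigma_eq lmul_proj diamond_H_proj flip: proj_add proj_scale)
qed

text \<open>If one of three words starts with \<open>y\<close>, that letter moves out of both bracketings; if one is
  empty, both bracketings coincide; otherwise all three start with \<open>\<sigma>\<close>, which moves out by
  multiplicativity.\<close>

lemma diamond_H_assoc:
  assumes "l \<noteq> 0"
  shows "diamond_H l (diamond_H l a b) c = diamond_H l a (diamond_H l b c)"
proof -
  note simps = diamond_H_one diamond_H_ymul
  have words: "diamond_H l (diamond_H l (ys_word l u) (ys_word l v)) (ys_word l w)
      = diamond_H l (ys_word l u) (diamond_H l (ys_word l v) (ys_word l w))" for u v w
    using assms
  proof (induction l u v arbitrary: w rule: diamond_word.induct)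
    case (5 l u v)
    show ?case
    proof (induction w rule: word_induct)
      case (3 w)
      then show ?case using 5 by (simp add: diamond_H_sigma)
    qed (simp_all add: simps)
  qed (simp_all add: simps)
  have 1: "diamond_H l (diamond_H l (ys_word l u) (ys_word l v)) c
      = diamond_H l (ys_word l u) (diamond_H l (ys_word l v) c)" for u v
    by (rule linear_eq_on_ys_words[where h = c, OF assms])
      (auto intro!: qlinearI simp: diamond_H_linear words)
  have 2: "diamond_H l (diamond_H l (ys_word l u) b) c
      = diamond_H l (ys_word l u) (diamond_H l b c)" for u
    by (rule linear_eq_on_ys_words[where h = b, OF assms])
      (auto intro!: qlinearI simp: diamond_H_linear 1)
  show ?thesis
    by (rule linear_eq_on_ys_words[where h = a, OF assms])
      (auto intro!: qlinearI simp: diamond_H_linear 2)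
qed


section \<open>The coproduct and the counit\<close>

lemma tmap_linear:
  assumes "qlinear f" "qlinear g"
  shows "tmap f g (s + t) = tmap f g s + tmap f g t" "tmap f g (c *\<^sub>Q t) = c *\<^sub>Q tmap f g t"
  using assms by (simp_all add: qlinear_add[OF qlinear_tmap] qlinear_scale[OF qlinear_tmap])

lemma qlinear_id: "qlinear id"
  by (rule qlinearI) simp_all

text \<open>On \<open>\<H> \<otimes> \<H>\<close> the coproducts of the letters \<open>y\<close> and \<open>\<sigma>\<close> act as \<open>1 \<otimes> y + y \<otimes> 1\<close> and as
  \<open>\<sigma> \<otimes> \<sigma>\<close>.\<close>

definition yprim :: "(H, H) tensor \<Rightarrow> (H, H) tensor"
  where "yprim t = tmap id ymul t + tmap ymul id t"

lemma yprim_tensor: "yprim (a \<otimes> b) = a \<otimes> ymul b + ymul a \<otimes> b"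
  by (simp add: yprim_def tmap_tensor qlinear_id qlinear_lmul)

lemma qlinear_yprim: "qlinear yprim"
  unfolding yprim_def[abs_def]
  by (intro qlinear_plus qlinear_tmap qlinear_id qlinear_lmul)

lemmas yprim_linear = qlinear_add[OF qlinear_yprim] qlinear_scale[OF qlinear_yprim]

definition sigma2 :: "rat \<Rightarrow> (H, H) tensor \<Rightarrow> (H, H) tensor"
  where "sigma2 l = tmap (sigma l) (sigma l)"

lemma qlinear_sigma2: "qlinear (sigma2 l)"
  unfolding sigma2_def by (intro qlinear_tmap qlinear_sigma)

lemma sigma2_tensor: "sigma2 l (a \<otimes> b) = sigma l a \<otimes> sigma l b"
  by (simp add: sigma2_def tmap_tensor qlinear_sigma)

lemmas sigma2_linear = qlinear_add[OF qlinear_sigma2] qlinear_scale[OF qlinear_sigma2]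

abbreviation proj2 :: "(free_alg, free_alg) tensor \<Rightarrow> (H, H) tensor"
  where "proj2 \<equiv> tmap proj proj"

lemmas proj2_linear = tmap_linear[OF qlinear_proj qlinear_proj]
lemmas proj2_tensor = tmap_tensor[OF qlinear_proj qlinear_proj]
lemmas tensor_linear = qbilinearD[OF qbilinear_tensor]

lemma proj2_tmul_d: "proj2 (tmul t (Delta_letter l Ld)) = 0"
proof -
  have T: "proj (p * word [Ld]) = 0" for p
    using T_minus_mult[OF T_minus_word[of "[]"]] by (simp add: proj_T_minus)
  show ?thesis
    by (rule tlift_unique[where t = t])
      (auto intro!: qlinearI simp: proj2_linear proj2_tensor tmul_simps tmul_tensor T tensor_linear
        scaleQ_add_right scaleQ_scaleQ mult.commute)
qed

text \<open>\<open>\<Delta>\<close> is defined by way of representatives in the span of \<open>Y\<close>.  In fact any representative may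
  be used, because each term of \<open>\<Delta>(wd) = \<Delta>(w)\<Delta>(d)\<close> has a tensor factor ending in \<open>d\<close>.\<close>

lemma Delta_H_proj: "Delta_H l (proj p) = proj2 (Delta_bar l p)"
proof -
  note lin = qlinear_comp[OF qlinear_Delta_bar qlinear_tmap[OF qlinear_proj qlinear_proj]]
  have w: "proj2 (Delta_bar l (word (w @ [Ld]))) = 0" for w
    using proj2_tmul_d[of "Delta_word l w" l]
    by (simp add: Delta_word_append tmul_one del: Delta_letter.simps)
  have zero: "proj2 (Delta_bar l q) = 0" if "q \<in> T_minus" for q
    by (rule qlinear_eq_0_on_span[OF lin _ that[unfolded T_minus_def]])
      (auto simp only: w)
  have "proj2 (Delta_bar l (restrict_Y p - p)) = 0"
    by (rule zero[OF restrict_Y_diff])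
  then show ?thesis
    by (simp add: Delta_H_def Yrep_proj qlinear_diff[OF lin])
qed

lemma qlinear_Delta_H: "qlinear (Delta_H l)"
proof (rule qlinearI)
  note s = Delta_H_proj proj2_linear qlinear_add[OF qlinear_Delta_bar] qlinear_scale[OF qlinear_Delta_bar]
  show "Delta_H l (h + k) = Delta_H l h + Delta_H l k" for h k
    using proj_surj[of h] proj_surj[of k] by (auto simp: s simp flip: proj_add)
  show "Delta_H l (c *\<^sub>Q h) = c *\<^sub>Q Delta_H l h" for c h
    using proj_surj[of h] by (auto simp: s simp flip: proj_scale)
qed

lemma Delta_H_one: "Delta_H l (proj 1) = proj 1 \<otimes> proj 1"
  by (simp add: Delta_H_proj Delta_bar_one proj2_tensor)

lemma Delta_H_ymul: "Delta_H l (ymul h) = yprim (Delta_H l h)"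
proof -
  obtain p where p: "h = proj p" using proj_surj by blast
  have "proj2 (tmul (Delta_letter l Ly) t) = yprim (proj2 t)" for t
    by (rule tlift_unique[where t = t])
      (auto intro!: qlinearI simp: proj2_linear proj2_tensor tmul_simps tmul_tensor yprim_tensor lmul_proj
        yprim_linear scaleQ_add_right)
  then show ?thesis
    by (simp add: p lmul_proj Delta_H_proj Delta_bar_mult tmul_one del: Delta_letter.simps)
qed

text \<open>\<open>\<sigma>\<close> is grouplike: \<open>(1 + \<lambda>d) \<otimes> (1 + \<lambda>d) = 1 \<otimes> 1 + \<lambda> (1 \<otimes> d + d \<otimes> 1 + \<lambda> d \<otimes> d)\<close>.\<close>

lemma Delta_H_sigma: "Delta_H l (sigma l h) = sigma2 l (Delta_H l h)"
proof -
  obtain p where p: "h = proj p" using proj_surj by blast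
  have "proj2 (t + l *\<^sub>Q tmul (Delta_letter l Ld) t) = sigma2 l (proj2 t)" for t
    by (rule tlift_unique[where t = t])
      (auto intro!: qlinearI simp: proj2_linear proj2_tensor tmul_simps tmul_tensor sigma2_tensor
        sigma2_linear sigma_eq lmul_proj
        tensor_linear scaleQ_add_right scaleQ_scaleQ mult.commute add.assoc add.left_commute)
  then have "proj2 (Delta_bar l (p + l *\<^sub>Q (word [Ld] * p))) = sigma2 l (proj2 (Delta_bar l p))"
    by (simp add: Delta_bar_mult tmul_one qlinear_add[OF qlinear_Delta_bar]
        qlinear_scale[OF qlinear_Delta_bar] del: Delta_letter.simps)
  then show ?thesis
    by (simp add: p sigma_eq lmul_proj Delta_H_proj flip: proj_add proj_scale)
qed

lemma qlinear_eps_H: "qlinear eps_H"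
proof (rule qlinearI)
  show "eps_H (h + k) = eps_H h + eps_H k" for h k
    using proj_surj[of h] proj_surj[of k]
    by (auto simp: eps_H_proj qlinear_add[OF qlinear_eps] simp flip: proj_add)
  show "eps_H (c *\<^sub>Q h) = c *\<^sub>Q eps_H h" for c h
    using proj_surj[of h] by (auto simp: eps_H_proj qlinear_scale[OF qlinear_eps] simp flip: proj_scale)
qed

lemma eps_H_one: "eps_H (proj 1) = 1"
  by (simp add: eps_H_proj eps_def scaleQ_one flip: word_Nil)

lemma eps_letter: "eps (word [x] * p) = 0"
proof -
  have "eps (word [x] * p) = (\<lambda>_. 0) p"
    by (rule free_linear_ext)
      (auto intro!: qlinearI simp: distrib_left scaleQ_mult_right word_mult
        qlinear_add[OF qlinear_eps] qlinear_scale[OF qlinear_eps], simp add: eps_def)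
  then show ?thesis .
qed

lemma eps_H_letter: "eps_H (lmul (word [x]) h) = 0"
  using proj_surj[of h] by (auto simp: lmul_proj eps_H_proj eps_letter)

lemma eps_H_sigma: "eps_H (sigma l h) = eps_H h"
  by (simp add: sigma_eq qlinear_add[OF qlinear_eps_H] qlinear_scale[OF qlinear_eps_H] eps_H_letter)


section \<open>The Hopf algebra axioms\<close>

lemma qlinear_tassoc: "qlinear tassoc"
  unfolding tassoc_def
  by (intro qlinear_tlift qbilinear_tlift_param qbilinearI qlinearI)
    (simp_all add: tensor_linear)

text \<open>In either bracketing the letter \<open>y\<close> acts on the triple tensor product as the sum of its three
  insertions, and \<open>\<sigma>\<close> acts diagonally.\<close>

lemma coassociative:
  assumes "l \<noteq> 0"
  shows "tassoc (tmap (Delta_H l) id (Delta_H l h)) = tmap id (Delta_H l) (Delta_H l h)"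
proof -
  \<comment> \<open>the actions of \<open>y\<close> and \<open>\<sigma>\<close> on \<open>\<H> \<otimes> (\<H> \<otimes> \<H>)\<close>\<close>
  define y3 :: "(H, (H, H) tensor) tensor \<Rightarrow> _" where "y3 t = tmap id yprim t + tmap ymul id t" for t
  define s3 :: "(H, (H, H) tensor) tensor \<Rightarrow> _" where "s3 = tmap (sigma l) (sigma2 l)"
  have y3: "y3 (a \<otimes> t) = a \<otimes> yprim t + ymul a \<otimes> t" for a t
    by (simp add: y3_def tmap_tensor qlinear_id qlinear_yprim qlinear_lmul)
  have s3: "s3 (a \<otimes> t) = sigma l a \<otimes> sigma2 l t" for a t
    by (simp add: s3_def tmap_tensor qlinear_sigma2 qlinear_sigma)
  have lin3: "qlinear y3" "qlinear s3"
    unfolding y3_def[abs_def] s3_def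
    by (intro qlinear_plus qlinear_tmap qlinear_id qlinear_yprim qlinear_lmul qlinear_sigma qlinear_sigma2)+
  note linl = qlinear_tmap[OF qlinear_Delta_H[of l] qlinear_id]
    and linr = qlinear_tmap[OF qlinear_id qlinear_Delta_H[of l]]
  note lin = lin3 linl linr qlinear_tassoc qlinear_Delta_H[of l]
  have pure: "tmap (Delta_H l) id (a \<otimes> b) = Delta_H l a \<otimes> b"
    "tmap id (Delta_H l) (a \<otimes> b) = a \<otimes> Delta_H l b" for a b
    by (simp_all add: tmap_tensor qlinear_id qlinear_Delta_H)
  note s = lin[THEN qlinear_add] lin[THEN qlinear_scale] yprim_linear sigma2_linear ops_linear
    pure tensor_linear y3 s3 yprim_tensor sigma2_tensor Delta_H_ymul Delta_H_sigma scaleQ_add_right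
  \<comment> \<open>The rule \<open>id_apply\<close> would rewrite the unapplied \<open>id\<close> into an abstraction, and the facts about
    \<open>tmap\<close> collected in \<open>s\<close> would no longer match.\<close>
  have ly: "tassoc (t \<otimes> ymul b + yprim t \<otimes> b) = y3 (tassoc (t \<otimes> b))" for t :: "(H, H) tensor" and b
    by (rule tlift_unique[where t = t]) (auto intro!: qlinearI simp del: id_apply simp add: s algebra_simps)
  have ls: "tassoc (sigma2 l t \<otimes> sigma l b) = s3 (tassoc (t \<otimes> b))" for t :: "(H, H) tensor" and b
    by (rule tlift_unique[where t = t]) (auto intro!: qlinearI simp del: id_apply simp add: s)
  have 1: "tassoc (tmap (Delta_H l) id (yprim t)) = y3 (tassoc (tmap (Delta_H l) id t))" for t
    by (rule tlift_unique[where t = t]) (auto intro!: qlinearI simp del: id_apply simp add: s simp flip: ly)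
  have 2: "tassoc (tmap (Delta_H l) id (sigma2 l t)) = s3 (tassoc (tmap (Delta_H l) id t))" for t
    by (rule tlift_unique[where t = t]) (auto intro!: qlinearI simp del: id_apply simp add: s ls)
  have 3: "tmap id (Delta_H l) (yprim t) = y3 (tmap id (Delta_H l) t)" for t
    by (rule tlift_unique[where t = t]) (auto intro!: qlinearI simp del: id_apply simp add: s)
  have 4: "tmap id (Delta_H l) (sigma2 l t) = s3 (tmap id (Delta_H l) t)" for t
    by (rule tlift_unique[where t = t]) (auto intro!: qlinearI simp del: id_apply simp add: s)
  show ?thesis
    by (rule linear_eq_by_letters[where h = h, OF assms])
      (auto intro!: qlinearI simp del: id_apply simp add: s 1 2 3 4 Delta_H_one)
qed

lemma counit:
  assumes "l \<noteq> 0"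
  shows "tlift (\<lambda>x y. eps_H x *\<^sub>Q y) (Delta_H l h) = h"
    and "tlift (\<lambda>x y. eps_H y *\<^sub>Q x) (Delta_H l h) = h"
proof -
  define L R where "L = tlift (\<lambda>x y. eps_H x *\<^sub>Q (y :: H))" and "R = tlift (\<lambda>x y. eps_H y *\<^sub>Q (x :: H))"
  note eps = qlinear_add[OF qlinear_eps_H] qlinear_scale[OF qlinear_eps_H] scaleQ_add_left
    scaleQ_add_right scaleQ_scaleQ mult.commute
  have bl: "qbilinear (\<lambda>x y. eps_H x *\<^sub>Q (y :: H))" "qbilinear (\<lambda>x y. eps_H y *\<^sub>Q (x :: H))"
    by (intro qbilinearI; simp add: eps)+
  have pure: "L (a \<otimes> b) = eps_H a *\<^sub>Q b" "R (a \<otimes> b) = eps_H b *\<^sub>Q a" for a b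
    by (simp_all add: L_def R_def bl)
  have lin: "qlinear L" "qlinear R"
    by (simp_all add: L_def R_def bl qlinear_tlift)
  note s = lin[THEN qlinear_add] lin[THEN qlinear_scale] pure ops_linear yprim_linear sigma2_linear
    yprim_tensor sigma2_tensor eps_H_letter eps_H_sigma
    qlinear_add[OF qlinear_Delta_H] qlinear_scale[OF qlinear_Delta_H]
  have 1: "L (yprim t) = ymul (L t)" "R (yprim t) = ymul (R t)"
    "L (sigma2 l t) = sigma l (L t)" "R (sigma2 l t) = sigma l (R t)" for t
    by (rule tlift_unique[where t = t]; auto intro!: qlinearI simp: s)+
  have "L (Delta_H l h) = h" "R (Delta_H l h) = h"
    by (rule linear_eq_by_letters[where h = h, OF assms];
        auto intro!: qlinearI simp: s 1 Delta_H_one Delta_H_ymul Delta_H_sigma eps_H_one scaleQ_one)+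
  then show "tlift (\<lambda>x y. eps_H x *\<^sub>Q y) (Delta_H l h) = h"
    "tlift (\<lambda>x y. eps_H y *\<^sub>Q x) (Delta_H l h) = h"
    by (simp_all add: L_def R_def)
qed

text \<open>\<open>1 \<otimes> y + y \<otimes> 1\<close> can be moved out of either factor of a product in \<open>\<H> \<otimes> \<H>\<close>, and \<open>\<sigma> \<otimes> \<sigma>\<close> is
  multiplicative there, so both sides obey the same recursion.\<close>

lemma Delta_H_diamond_H:
  assumes "l \<noteq> 0"
  shows "Delta_H l (diamond_H l a b) = tmult (diamond_H l) (diamond_H l) (Delta_H l a) (Delta_H l b)"
proof -
  let ?M = "tmult (diamond_H l) (diamond_H l)"
  note bl = qbilinear_diamond_H[of l]
  note s = qbilinearD[OF qbilinear_tmult[OF bl bl]] tmult_tensor[OF bl bl] yprim_linear sigma2_linear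
    yprim_tensor sigma2_tensor diamond_H_ymul diamond_H_sigma[OF assms] diamond_H_one diamond_H_linear
    qlinear_add[OF qlinear_Delta_H] qlinear_scale[OF qlinear_Delta_H]
  have 1: "?M (yprim r) t = yprim (?M r t)" for r t
    by (rule tensor_bilinear_ext[where s = r and t = t]) (auto intro!: qbilinearI simp: s)
  have 2: "?M r (yprim t) = yprim (?M r t)" for r t
    by (rule tensor_bilinear_ext[where s = r and t = t]) (auto intro!: qbilinearI simp: s)
  have 3: "?M (sigma2 l r) (sigma2 l t) = sigma2 l (?M r t)" for r t
    by (rule tensor_bilinear_ext[where s = r and t = t]) (auto intro!: qbilinearI simp: s)
  have 4: "?M (proj 1 \<otimes> proj 1) t = t" "?M t (proj 1 \<otimes> proj 1) = t" for t
    by (rule tlift_unique[where t = t]; auto intro!: qlinearI simp: s)+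
  show ?thesis
    by (rule bilinear_eq_by_letters[where a = a and b = b, OF assms])
      (auto intro!: qbilinearI simp: s 1 2 3 4 Delta_H_one Delta_H_ymul Delta_H_sigma)
qed

lemma eps_H_diamond_H:
  assumes "l \<noteq> 0"
  shows "eps_H (diamond_H l a b) = eps_H a * eps_H b"
  by (rule bilinear_eq_by_letters[where a = a and b = b, OF assms])
    (auto intro!: qbilinearI simp: diamond_H_linear diamond_H_one diamond_H_ymul diamond_H_sigma[OF assms]
      qlinear_add[OF qlinear_eps_H] qlinear_scale[OF qlinear_eps_H] eps_H_letter eps_H_sigma eps_H_one
      distrib_left distrib_right)


section \<open>The antipode\<close>

text \<open>The antipode must satisfy \<open>S(y h) = - y S(h)\<close> and \<open>S(\<sigma> h) = \<sigma> S(h)\<close>, hence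
  \<open>S(d h) = d S(h)\<close>.\<close>

definition ysign :: "free_alg \<Rightarrow> free_alg"
  where "ysign = lin_ext (\<lambda>w. (-1) ^ count_list w Ly *\<^sub>Q word w)"

lemma qlinear_ysign: "qlinear ysign"
  unfolding ysign_def by (rule qlinear_lin_ext)

lemma ysign_word: "ysign (word w) = (-1) ^ count_list w Ly *\<^sub>Q word w"
  by (simp add: ysign_def scaleQ_one)

lemma ysign_letter: "ysign (word [x] * p) = (if x = Ly then -1 else 1) *\<^sub>Q (word [x] * ysign p)"
  by (rule free_linear_ext[where p = p])
    (auto intro!: qlinearI simp: qlinear_add[OF qlinear_ysign] qlinear_scale[OF qlinear_ysign]
      distrib_left scaleQ_mult_right word_mult ysign_word scaleQ_one scaleQ_scaleQ scaleQ_add_right)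

lift_definition antipode_H :: "H \<Rightarrow> H" is ysign
proof -
  fix p q
  assume "p - q \<in> T_minus"
  have "proj (ysign (p - q)) = 0"
    by (rule qlinear_eq_0_on_span[OF qlinear_comp[OF qlinear_ysign qlinear_proj] _
          \<open>p - q \<in> T_minus\<close>[unfolded T_minus_def]])
      (auto simp: ysign_def proj_scale scaleQ_one proj_T_minus[OF T_minus_word])
  then show "ysign p - ysign q \<in> T_minus"
    by (simp add: qlinear_diff[OF qlinear_ysign] qlinear_diff[OF qlinear_proj] flip: proj_eq_iff)
qed

lemma antipode_H_proj: "antipode_H (proj p) = proj (ysign p)"
  by (simp add: proj_def antipode_H.abs_eq)

lemma qlinear_antipode_H: "qlinear antipode_H"
proof (rule qlinearI)
  show "antipode_H (h + k) = antipode_H h + antipode_H k" for h k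
    using proj_surj[of h] proj_surj[of k]
    by (auto simp: antipode_H_proj qlinear_add[OF qlinear_ysign] simp flip: proj_add)
  show "antipode_H (c *\<^sub>Q h) = c *\<^sub>Q antipode_H h" for c h
    using proj_surj[of h]
    by (auto simp: antipode_H_proj qlinear_scale[OF qlinear_ysign] simp flip: proj_scale)
qed

lemmas antipode_H_linear = qlinear_add[OF qlinear_antipode_H] qlinear_scale[OF qlinear_antipode_H]

lemma antipode_H_one: "antipode_H (proj 1) = proj 1"
  by (simp add: antipode_H_proj ysign_def scaleQ_one flip: word_Nil)

lemma antipode_H_letter:
  "antipode_H (lmul (word [x]) h) = (if x = Ly then -1 else 1) *\<^sub>Q lmul (word [x]) (antipode_H h)"
proof -
  obtain p where "h = proj p" using proj_surj by blast
  then show ?thesis by (simp only: lmul_proj antipode_H_proj ysign_letter proj_scale)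
qed

lemma antipode_H_ymul: "antipode_H (ymul h) = - ymul (antipode_H h)"
  by (simp add: antipode_H_letter)

lemma antipode_H_sigma: "antipode_H (sigma l h) = sigma l (antipode_H h)"
  by (simp add: sigma_eq antipode_H_linear antipode_H_letter scaleQ_one)

text \<open>Applied to \<open>1 \<otimes> y + y \<otimes> 1\<close>, both convolutions of \<open>S\<close> with the identity produce two
  cancelling terms; \<open>\<sigma>\<close> passes through them and fixes the resulting multiple of \<open>1\<close>.\<close>

lemma antipode_antipode_H:
  assumes "l \<noteq> 0"
  shows "antipode (diamond_H l) eta_H (Delta_H l) eps_H antipode_H"
proof -
  let ?m = "tlift (diamond_H l)"
  note lin = qlinear_tlift[OF qbilinear_diamond_H[of l]] qlinear_antipode_H
    qlinear_tmap[OF qlinear_antipode_H qlinear_id] qlinear_tmap[OF qlinear_id qlinear_antipode_H]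
    qlinear_Delta_H[of l] qlinear_eps_H
  have pure: "tmap antipode_H id (a \<otimes> b) = antipode_H a \<otimes> b"
    "tmap id antipode_H (a \<otimes> b) = a \<otimes> antipode_H b" for a b
    by (simp_all add: tmap_tensor qlinear_id qlinear_antipode_H)
  have neg: "diamond_H l (- a) b = - diamond_H l a b" "diamond_H l a (- b) = - diamond_H l a b" for a b
    using diamond_H_linear(5)[of l 0 a b] diamond_H_linear(6)[of l a 0 b]
    by (simp_all add: diamond_H_linear(7,8))
  note s = lin[THEN qlinear_add] lin[THEN qlinear_scale] yprim_linear sigma2_linear ops_linear
    pure tlift_tensor[OF qbilinear_diamond_H] yprim_tensor sigma2_tensor
    antipode_H_ymul antipode_H_sigma diamond_H_linear neg diamond_H_ymul diamond_H_sigma[OF assms]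
  have 1: "?m (tmap antipode_H id (yprim t)) = 0" "?m (tmap id antipode_H (yprim t)) = 0" for t
    by (rule tlift_unique[where t = t]; auto intro!: qlinearI simp del: id_apply simp add: s)+
  have 2: "?m (tmap antipode_H id (sigma2 l t)) = sigma l (?m (tmap antipode_H id t))"
    "?m (tmap id antipode_H (sigma2 l t)) = sigma l (?m (tmap id antipode_H t))" for t
    by (rule tlift_unique[where t = t]; auto intro!: qlinearI simp del: id_apply simp add: s)+
  have eta: "eta_H c = c *\<^sub>Q proj 1" for c
    by (simp add: eta_H_def eta_def proj_scale word_Nil)
  have "?m (tmap antipode_H id (Delta_H l h)) = eps_H h *\<^sub>Q proj 1"
    "?m (tmap id antipode_H (Delta_H l h)) = eps_H h *\<^sub>Q proj 1" for h
    by (rule linear_eq_by_letters[where h = h, OF assms];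
        auto intro!: qlinearI simp del: id_apply simp add: s 1 2 Delta_H_one Delta_H_ymul Delta_H_sigma
          eps_H_one eps_H_letter eps_H_sigma antipode_H_one diamond_H_one sigma_one scaleQ_add_left scaleQ_scaleQ)+
  then show ?thesis
    by (simp add: antipode_def eta qlinear_antipode_H)
qed

theorem theorem3p18:
  fixes l :: rat
  assumes "l \<noteq> 0"
  shows "hopf_algebra (diamond_H l) eta_H (Delta_H l) eps_H"
proof -
  have eta: "eta_H 1 = proj 1"
    by (simp add: eta_H_def eta_def scaleQ_one word_Nil)
  have "qlinear eta_H"
    by (rule qlinearI)
      (simp_all add: eta_H_def eta_def proj_add proj_scale scaleQ_add_left flip: scaleQ_scaleQ)
  then have "algebra_axioms (diamond_H l) eta_H"
    by (simp add: algebra_axioms_def qbilinear_diamond_H diamond_H_assoc[OF assms] eta diamond_H_one)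
  moreover have "coalgebra_axioms (Delta_H l) eps_H"
    by (simp add: coalgebra_axioms_def qlinear_Delta_H qlinear_eps_H coassociative[OF assms]
        counit[OF assms])
  ultimately have "bialgebra (diamond_H l) eta_H (Delta_H l) eps_H"
    by (simp add: bialgebra_def eta Delta_H_diamond_H[OF assms] eps_H_diamond_H[OF assms]
        Delta_H_one eps_H_one)
  then show ?thesis
    using antipode_antipode_H[OF assms] by (auto simp: hopf_algebra_def)
qed

end
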